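(* Let $P_1,\dots,P_\nu$ be systems with $p\times m$ real-rational proper transfer functions, and let $P_i=N_iM_i^{-1}=\tilde M_i^{-1}\tilde N_i$ be right and left coprime factorizations over $H_\infty$. Then: (i) there exists $\lambda\in\bar{\mathbb C}_0$ such that $\bigcap_{i=1}^\nu\ker\,[M_i(\lambda)]^\top\ne\{0\}$ if and only if there exists $\lambda\in\bar{\mathbb C}_0$ such that $\bigcap_{i=1}^\nu\mathrm{pdir_i}(P_i,\lambda)\ne\{0\}$; (ii) there exists $\lambda\in\bar{\mathbb C}_0$ such that $\bigcap_{i=1}^\nu\ker\tilde M_i(\lambda)\ne\{0\}$ if and only if there exists $\lambda\in\bar{\mathbb C}_0$ such that $\bigcap_{i=1}^\nu\mathrm{pdir_o}(P_i,\lambda)\ne\{0\}$.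
   Context: **Notation.** $\mathbb C_0=\{s\in\mathbb C:\operatorname{Re}s>0\}$, $\bar{\mathbb C}_0=\{s\in\mathbb C:\operatorname{Re}s\ge0\}$. $A^\top$ denotes the complex-conjugate transpose of a matrix $A$. $H_\infty^{p\times m}$ is the space of bounded holomorphic functions $\mathbb C_0\to\mathbb C^{p\times m}$; $H_\infty$ is written when dimensions are clear. **Coprime factorizations.** $M\in H_\infty^{m\times m}$, $N\in H_\infty^{p\times m}$ are right coprime if there are $X,Y\in H_\infty$ with $XM+YN=I_m$. $\tilde M\in H_\infty^{p\times p}$, $\tilde N\in H_\infty^{p\times m}$ are left coprime if there are $\tilde X,\tilde Y\in H_\infty$ with $\tilde M\tilde X+\tilde N\tilde Y=I_p$. The denominators $M_i,\tilde M_i$ are taken to extend continuously to $\bar{\mathbb C}_0$ (as is automatic for real-rational factors), so that their values at imaginary-axis points make sense. **Pole directions.** Let $G(s)=D+C(sI-A)^{-1}B$ be a $p\times m$ proper rational transfer function with $(A,B,C,D)$ a minimal state-space realization. The input and output directions of $\lambda\in\mathbb C$ as a pole of $G$ are the subspaces $$\mathrm{pdir_i}(G,\lambda)=B^\top\ker(\lambda I-A)^\top\subset\mathbb C^m,\qquad\mathrm{pdir_o}(G,\lambda)=C\ker(\lambda I-A)\subset\mathbb C^p.$$ They do not depend on the choice of minimal realization, and equal $\{0\}$ if $\lambda$ is not a pole of $G$. *)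

theory Defs
  imports
    "HOL-Complex_Analysis.Complex_Analysis"
    "HOL-Computational_Algebra.Normalized_Fraction"
    "HOL-Computational_Algebra.Polynomial_Factorial"
    "HOL-Computational_Algebra.Field_as_Ring"
    "Jordan_Normal_Form.Matrix_Kernel"
    "Jordan_Normal_Form.Gauss_Jordan_Elimination"
    "Jordan_Normal_Form.Schur_Decomposition"
begin

definition open_rhp :: "complex set" where
  "open_rhp = {s. Re s > 0}"

definition closed_rhp :: "complex set" where
  "closed_rhp = {s. Re s \<ge> 0}"

text \<open>
  In this development \<open>\<^sup>\<top>\<close> is the complex-conjugate transpose, i.e.\ \<^const>\<open>mat_adjoint\<close>.
  The inverse of a square matrix is only meaningful where the matrix is invertible; every use
  below is guarded by a nonvanishing determinant.
\<close>

definition mat_inv :: "complex mat \<Rightarrow> complex mat" where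
  "mat_inv A = the (mat_inverse A)"

subsection \<open>Real-rational transfer functions\<close>

text \<open>
  A real-rational transfer function is a matrix over the field of fractions of real polynomials.
  \<^const>\<open>quot_of_fract\<close> returns the fraction in lowest terms, so the zeros of its second
  component are exactly the poles of the scalar rational function.
\<close>

definition fract_proper :: "real poly fract \<Rightarrow> bool" where
  "fract_proper f \<longleftrightarrow> degree (fst (quot_of_fract f)) \<le> degree (snd (quot_of_fract f))"

definition fract_pole :: "real poly fract \<Rightarrow> complex \<Rightarrow> bool" where
  "fract_pole f s \<longleftrightarrow> poly (map_poly of_real (snd (quot_of_fract f))) s = 0"

definition fract_eval :: "real poly fract \<Rightarrow> complex \<Rightarrow> complex" where
  "fract_eval f s =
     poly (map_poly of_real (fst (quot_of_fract f))) s / poly (map_poly of_real (snd (quot_of_fract f))) s"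

definition proper_tf :: "real poly fract mat \<Rightarrow> bool" where
  "proper_tf G \<longleftrightarrow> (\<forall>j<dim_row G. \<forall>k<dim_col G. fract_proper (G $$ (j, k)))"

definition tf_pole :: "real poly fract mat \<Rightarrow> complex \<Rightarrow> bool" where
  "tf_pole G s \<longleftrightarrow> (\<exists>j<dim_row G. \<exists>k<dim_col G. fract_pole (G $$ (j, k)) s)"

definition tf_eval :: "real poly fract mat \<Rightarrow> complex \<Rightarrow> complex mat" where
  "tf_eval G s = map_mat (\<lambda>f. fract_eval f s) G"

subsection \<open>Minimal realizations and pole directions\<close>

text \<open>
  The identity \<open>G(s) = D + C (sI - A)\<^sup>-\<^sup>1 B\<close> of rational functions is stated pointwise, at all
  points where both sides are defined (all but finitely many). The state dimension may be 0.
\<close>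

definition realization ::
  "real poly fract mat \<Rightarrow> complex mat \<Rightarrow> complex mat \<Rightarrow> complex mat \<Rightarrow> complex mat \<Rightarrow> bool" where
  "realization G A B C D \<longleftrightarrow>
     A \<in> carrier_mat (dim_row A) (dim_row A) \<and>
     B \<in> carrier_mat (dim_row A) (dim_col G) \<and>
     C \<in> carrier_mat (dim_row G) (dim_row A) \<and>
     D \<in> carrier_mat (dim_row G) (dim_col G) \<and>
     (\<forall>s. det (s \<cdot>\<^sub>m 1\<^sub>m (dim_row A) - A) \<noteq> 0 \<and> \<not> tf_pole G s \<longrightarrow>
        tf_eval G s = D + C * mat_inv (s \<cdot>\<^sub>m 1\<^sub>m (dim_row A) - A) * B)"

definition minimal_realization ::
  "real poly fract mat \<Rightarrow> complex mat \<Rightarrow> complex mat \<Rightarrow> complex mat \<Rightarrow> complex mat \<Rightarrow> bool" where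
  "minimal_realization G A B C D \<longleftrightarrow>
     realization G A B C D \<and>
     (\<forall>A' B' C' D'. realization G A' B' C' D' \<longrightarrow> dim_row A \<le> dim_row A')"

text \<open>
  The pole directions do not depend on the choice of the minimal realization, so an arbitrary
  one is picked. A realization exists whenever \<open>G\<close> is proper.
\<close>

definition some_minimal_realization ::
  "real poly fract mat \<Rightarrow> complex mat \<times> complex mat \<times> complex mat \<times> complex mat" where
  "some_minimal_realization G = (SOME (A, B, C, D). minimal_realization G A B C D)"

definition pdir_i :: "real poly fract mat \<Rightarrow> complex \<Rightarrow> complex vec set" where
  "pdir_i G l =
     (case some_minimal_realization G of (A, B, C, D) \<Rightarrow>
        (\<lambda>v. mat_adjoint B *\<^sub>v v) ` mat_kernel (mat_adjoint (l \<cdot>\<^sub>m 1\<^sub>m (dim_row A) - A)))"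

definition pdir_o :: "real poly fract mat \<Rightarrow> complex \<Rightarrow> complex vec set" where
  "pdir_o G l =
     (case some_minimal_realization G of (A, B, C, D) \<Rightarrow>
        (\<lambda>v. C *\<^sub>v v) ` mat_kernel (l \<cdot>\<^sub>m 1\<^sub>m (dim_row A) - A))"

subsection \<open>Coprime factorizations over \<open>H\<^sub>\<infinity>\<close>\<close>

text \<open>
  Boundedness and holomorphy of a matrix-valued function are equivalent to boundedness and
  holomorphy of all its entries.
\<close>

definition H_inf :: "nat \<Rightarrow> nat \<Rightarrow> (complex \<Rightarrow> complex mat) set" where
  "H_inf p m = {F.
     (\<forall>s\<in>open_rhp. F s \<in> carrier_mat p m) \<and>
     (\<forall>j<p. \<forall>k<m. (\<lambda>s. F s $$ (j, k)) holomorphic_on open_rhp \<and>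
                   bounded ((\<lambda>s. F s $$ (j, k)) ` open_rhp))}"

definition right_coprime ::
  "nat \<Rightarrow> nat \<Rightarrow> (complex \<Rightarrow> complex mat) \<Rightarrow> (complex \<Rightarrow> complex mat) \<Rightarrow> bool" where
  "right_coprime p m M N \<longleftrightarrow> M \<in> H_inf m m \<and> N \<in> H_inf p m \<and>
     (\<exists>X\<in>H_inf m m. \<exists>Y\<in>H_inf m p. \<forall>s\<in>open_rhp. X s * M s + Y s * N s = 1\<^sub>m m)"

definition left_coprime ::
  "nat \<Rightarrow> nat \<Rightarrow> (complex \<Rightarrow> complex mat) \<Rightarrow> (complex \<Rightarrow> complex mat) \<Rightarrow> bool" where
  "left_coprime p m M N \<longleftrightarrow> M \<in> H_inf p p \<and> N \<in> H_inf p m \<and>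
     (\<exists>X\<in>H_inf p p. \<exists>Y\<in>H_inf m p. \<forall>s\<in>open_rhp. M s * X s + N s * Y s = 1\<^sub>m p)"

text \<open>
  A function on the open half-plane that extends continuously to the closed one is represented
  by its (unique) extension.
\<close>

definition continuous_on_closed_rhp :: "nat \<Rightarrow> (complex \<Rightarrow> complex mat) \<Rightarrow> bool" where
  "continuous_on_closed_rhp n M \<longleftrightarrow>
     (\<forall>s\<in>closed_rhp. M s \<in> carrier_mat n n) \<and>
     (\<forall>j<n. \<forall>k<n. continuous_on closed_rhp (\<lambda>s. M s $$ (j, k)))"

text \<open>
  \<open>G = N M\<^sup>-\<^sup>1\<close> and \<open>G = M\<^sup>-\<^sup>1 N\<close> are identities of meromorphic functions: \<open>det M\<close> is not
  identically zero, and equality holds wherever both sides are defined.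
\<close>

definition right_coprime_factorization ::
  "real poly fract mat \<Rightarrow> (complex \<Rightarrow> complex mat) \<Rightarrow> (complex \<Rightarrow> complex mat) \<Rightarrow> bool" where
  "right_coprime_factorization G M N \<longleftrightarrow>
     right_coprime (dim_row G) (dim_col G) M N \<and>
     continuous_on_closed_rhp (dim_col G) M \<and>
     (\<exists>s\<in>open_rhp. det (M s) \<noteq> 0) \<and>
     (\<forall>s\<in>open_rhp. det (M s) \<noteq> 0 \<and> \<not> tf_pole G s \<longrightarrow> tf_eval G s = N s * mat_inv (M s))"

definition left_coprime_factorization ::
  "real poly fract mat \<Rightarrow> (complex \<Rightarrow> complex mat) \<Rightarrow> (complex \<Rightarrow> complex mat) \<Rightarrow> bool" where
  "left_coprime_factorization G M N \<longleftrightarrow>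
     left_coprime (dim_row G) (dim_col G) M N \<and>
     continuous_on_closed_rhp (dim_row G) M \<and>
     (\<exists>s\<in>open_rhp. det (M s) \<noteq> 0) \<and>
     (\<forall>s\<in>open_rhp. det (M s) \<noteq> 0 \<and> \<not> tf_pole G s \<longrightarrow> tf_eval G s = mat_inv (M s) * N s)"

end

theory Submission
  imports Defs
begin

text \<open>
  For every \<open>l\<close> in the closed half-plane the two subspaces coincide: \<open>ker M(l) = C ker(lI - A)\<close>
  for a left denominator \<open>M\<close> and any minimal realization, and the adjoint statement for right
  denominators follows by transposition. Let \<open>s \<rightarrow> l\<close> through points of the open half-plane where
  everything is regular; only \<open>M\<close> needs to converge, the other factors are merely bounded.

  If \<open>M(l) y = 0\<close>, put \<open>u = M(s) y \<rightarrow> 0\<close> and \<open>x = (sI - A)\<^sup>-\<^sup>1 B Y(s) u\<close>. The Bezout identity gives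
  \<open>M\<^sup>-\<^sup>1 = X + G Y\<close>, so \<open>C x \<rightarrow> y\<close>, while \<open>(sI - A) x \<rightarrow> 0\<close>. Observability, in the form
  \<open>K (lI - A) + L C = I\<close>, forces \<open>x\<close> to converge to some \<open>v\<close> with \<open>(lI - A) v = 0\<close> and \<open>C v = y\<close>.

  Conversely, if \<open>(lI - A) v = 0\<close>, controllability \<open>(lI - A) U + B V = I\<close> gives
  \<open>v = U g + (sI - A)\<^sup>-\<^sup>1 B V g\<close> with \<open>g = (s - l) (I + (s - l) U)\<^sup>-\<^sup>1 v \<rightarrow> 0\<close>. Hence
  \<open>M C v = M C U g + N V g - M D V g \<rightarrow> 0\<close>.
\<close>

subsection \<open>Matrix inverses and entrywise limits\<close>

lemma mat_inv:
  assumes "A \<in> carrier_mat n n" "det A \<noteq> 0"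
  shows "mat_inv A \<in> carrier_mat n n" "A * mat_inv A = 1\<^sub>m n" "mat_inv A * A = 1\<^sub>m n"
proof -
  \<comment> \<open>\<open>undefined\<close> only fills the record extension of the matrix ring;
    being a unit does not depend on it.\<close>
  have "A \<in> Units (ring_mat TYPE(complex) n undefined)"
    using det_non_zero_imp_unit[OF assms] .
  then obtain B where B: "mat_inverse A = Some B"
    using mat_inverse(1)[OF assms(1), where b = undefined] by (cases "mat_inverse A") auto
  show "mat_inv A \<in> carrier_mat n n" "A * mat_inv A = 1\<^sub>m n" "mat_inv A * A = 1\<^sub>m n"
    using mat_inverse(2)[OF assms(1) B] by (auto simp: mat_inv_def B)
qed

text \<open>Multiply the equation by the inverse from the left. This evaluates a resolvent applied
  to \<open>B\<close> by exhibiting a solution of the linear equation, so no inverse has to be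
  computed.\<close>

lemma mat_inv_mult_eqI:
  assumes "A \<in> carrier_mat n n" "det A \<noteq> 0" "X \<in> carrier_mat n k" "A * X = B"
  shows "mat_inv A * B = X"
proof -
  have "mat_inv A * B = (mat_inv A * A) * X"
    using assms mat_inv(1)[OF assms(1,2)] by (auto simp: assoc_mult_mat[of _ n n _ n _ k])
  then show ?thesis using mat_inv(3)[OF assms(1,2)] assms(3) by simp
qed

lemma mat_inv_unique:
  assumes "A \<in> carrier_mat n n" "det A \<noteq> 0" "X \<in> carrier_mat n n" "A * X = 1\<^sub>m n"
  shows "mat_inv A = X"
  using mat_inv_mult_eqI[OF assms] mat_inv(1)[OF assms(1,2)] by simp

text \<open>Cramer's rule makes the entries of the inverse polynomials in those of \<open>A\<close>
  divided by \<open>det A\<close>; continuity of inversion rests on this.\<close>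

lemma mat_inv_adj:
  assumes "A \<in> carrier_mat n n" "det A \<noteq> 0"
  shows "mat_inv A = inverse (det A) \<cdot>\<^sub>m adj_mat A"
proof (rule mat_inv_unique[OF assms])
  show "inverse (det A) \<cdot>\<^sub>m adj_mat A \<in> carrier_mat n n"
    using adj_mat(1)[OF assms(1)] by simp
  show "A * (inverse (det A) \<cdot>\<^sub>m adj_mat A) = 1\<^sub>m n"
    using adj_mat(1,2)[OF assms(1)] assms
    by (auto simp: mult_smult_distrib[OF assms(1)] intro!: eq_matI)
qed

lemma mat_inv_transpose:
  assumes "A \<in> carrier_mat n n" "det A \<noteq> 0"
  shows "mat_inv A\<^sup>T = (mat_inv A)\<^sup>T"
proof (rule mat_inv_unique)
  show "A\<^sup>T * (mat_inv A)\<^sup>T = 1\<^sub>m n"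
    using transpose_mult[of "mat_inv A" n n A n] mat_inv[OF assms] assms by simp
qed (use assms mat_inv(1)[OF assms] det_transpose[OF assms(1)] in auto)

section \<open>Entrywise convergence along a filter\<close>

text \<open>Dimensions belong to the value and not to the type, so convergence is taken entry by
  entry. The dimension of \<open>f s\<close> is required only eventually, because members of
  \<open>H_inf\<close> have prescribed dimensions only on the open half-plane.\<close>

definition mat_tendsto ::
  "('a \<Rightarrow> complex mat) \<Rightarrow> complex mat \<Rightarrow> nat \<Rightarrow> nat \<Rightarrow> 'a filter \<Rightarrow> bool" where
  "mat_tendsto f L p m F \<longleftrightarrow> (\<forall>\<^sub>F s in F. f s \<in> carrier_mat p m) \<and> L \<in> carrier_mat p m \<and>
     (\<forall>i<p. \<forall>j<m. ((\<lambda>s. f s $$ (i, j)) \<longlongrightarrow> L $$ (i, j)) F)"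

definition vec_tendsto ::
  "('a \<Rightarrow> complex vec) \<Rightarrow> complex vec \<Rightarrow> nat \<Rightarrow> 'a filter \<Rightarrow> bool" where
  "vec_tendsto f L p F \<longleftrightarrow> (\<forall>\<^sub>F s in F. f s \<in> carrier_vec p) \<and> L \<in> carrier_vec p \<and>
     (\<forall>i<p. ((\<lambda>s. f s $ i) \<longlongrightarrow> L $ i) F)"

lemma mat_tendsto_const: "L \<in> carrier_mat p m \<Longrightarrow> mat_tendsto (\<lambda>_. L) L p m F"
  by (simp add: mat_tendsto_def)

lemma vec_tendsto_const: "L \<in> carrier_vec p \<Longrightarrow> vec_tendsto (\<lambda>_. L) L p F"
  by (simp add: vec_tendsto_def)

lemma mat_tendsto_cong:
  assumes "mat_tendsto f L p m F" "\<forall>\<^sub>F s in F. g s = f s"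
  shows "mat_tendsto g L p m F"
proof -
  have "((\<lambda>s. g s $$ (i, j)) \<longlongrightarrow> L $$ (i, j)) F" if "i < p" "j < m" for i j
    using assms that unfolding mat_tendsto_def
    by (subst tendsto_cong[where g = "\<lambda>s. f s $$ (i, j)"]) (auto elim: eventually_mono)
  moreover have "\<forall>\<^sub>F s in F. g s \<in> carrier_mat p m"
    using assms unfolding mat_tendsto_def by (auto elim: eventually_elim2)
  ultimately show ?thesis using assms by (auto simp: mat_tendsto_def)
qed

lemma vec_tendsto_cong:
  assumes "vec_tendsto f L p F" "\<forall>\<^sub>F s in F. g s = f s"
  shows "vec_tendsto g L p F"
proof -
  have "((\<lambda>s. g s $ i) \<longlongrightarrow> L $ i) F" if "i < p" for i
    using assms that unfolding vec_tendsto_def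
    by (subst tendsto_cong[where g = "\<lambda>s. f s $ i"]) (auto elim: eventually_mono)
  moreover have "\<forall>\<^sub>F s in F. g s \<in> carrier_vec p"
    using assms unfolding vec_tendsto_def by (auto elim: eventually_elim2)
  ultimately show ?thesis using assms by (auto simp: vec_tendsto_def)
qed

lemma mat_tendsto_unique:
  assumes "F \<noteq> bot" "mat_tendsto f L p m F" "mat_tendsto f K p m F"
  shows "L = K"
proof (rule eq_matI)
  fix i j assume "i < dim_row K" "j < dim_col K"
  then show "L $$ (i, j) = K $$ (i, j)"
    using assms(2,3) by (intro tendsto_unique[OF assms(1), of "\<lambda>s. f s $$ (i, j)"]) (auto simp: mat_tendsto_def)
qed (use assms in \<open>auto simp: mat_tendsto_def\<close>)

lemma vec_tendsto_unique:
  assumes "F \<noteq> bot" "vec_tendsto f L p F" "vec_tendsto f K p F"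
  shows "L = K"
proof (rule eq_vecI)
  fix i assume "i < dim_vec K"
  then show "L $ i = K $ i"
    using assms(2,3) by (intro tendsto_unique[OF assms(1), of "\<lambda>s. f s $ i"]) (auto simp: vec_tendsto_def)
qed (use assms in \<open>auto simp: vec_tendsto_def\<close>)

lemma mat_tendsto_mult:
  assumes "mat_tendsto f L p n F" "mat_tendsto g K n m F"
  shows "mat_tendsto (\<lambda>s. f s * g s) (L * K) p m F"
proof -
  have ev: "\<forall>\<^sub>F s in F. f s \<in> carrier_mat p n \<and> g s \<in> carrier_mat n m"
    using assms by (auto simp: mat_tendsto_def intro: eventually_conj)
  have "((\<lambda>s. (f s * g s) $$ (i, j)) \<longlongrightarrow> (L * K) $$ (i, j)) F" if "i < p" "j < m" for i j
  proof -
    have "((\<lambda>s. \<Sum>k<n. f s $$ (i, k) * g s $$ (k, j)) \<longlongrightarrow> (\<Sum>k<n. L $$ (i, k) * K $$ (k, j))) F"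
      using assms that by (intro tendsto_intros) (auto simp: mat_tendsto_def)
    moreover have "\<forall>\<^sub>F s in F. (\<Sum>k<n. f s $$ (i, k) * g s $$ (k, j)) = (f s * g s) $$ (i, j)"
      using ev by eventually_elim (use that in \<open>auto simp: scalar_prod_def atLeast0LessThan\<close>)
    moreover have "(\<Sum>k<n. L $$ (i, k) * K $$ (k, j)) = (L * K) $$ (i, j)"
      using that assms by (auto simp: mat_tendsto_def scalar_prod_def atLeast0LessThan)
    ultimately show ?thesis by (auto elim: Lim_transform_eventually)
  qed
  moreover have "\<forall>\<^sub>F s in F. f s * g s \<in> carrier_mat p m"
    using ev by eventually_elim auto
  ultimately show ?thesis using assms by (auto simp: mat_tendsto_def)
qed

lemma mat_tendsto_mult_vec:
  assumes "mat_tendsto f L p n F" "vec_tendsto g K n F"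
  shows "vec_tendsto (\<lambda>s. f s *\<^sub>v g s) (L *\<^sub>v K) p F"
proof -
  have ev: "\<forall>\<^sub>F s in F. f s \<in> carrier_mat p n \<and> g s \<in> carrier_vec n"
    using assms by (auto simp: mat_tendsto_def vec_tendsto_def intro: eventually_conj)
  have "((\<lambda>s. (f s *\<^sub>v g s) $ i) \<longlongrightarrow> (L *\<^sub>v K) $ i) F" if "i < p" for i
  proof -
    have "((\<lambda>s. \<Sum>k<n. f s $$ (i, k) * g s $ k) \<longlongrightarrow> (\<Sum>k<n. L $$ (i, k) * K $ k)) F"
      using assms that by (intro tendsto_intros) (auto simp: mat_tendsto_def vec_tendsto_def)
    moreover have "\<forall>\<^sub>F s in F. (\<Sum>k<n. f s $$ (i, k) * g s $ k) = (f s *\<^sub>v g s) $ i"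
      using ev by eventually_elim (use that in \<open>auto simp: scalar_prod_def atLeast0LessThan\<close>)
    moreover have "(\<Sum>k<n. L $$ (i, k) * K $ k) = (L *\<^sub>v K) $ i"
      using that assms
      by (auto simp: mat_tendsto_def vec_tendsto_def scalar_prod_def atLeast0LessThan)
    ultimately show ?thesis by (auto elim: Lim_transform_eventually)
  qed
  moreover have "\<forall>\<^sub>F s in F. f s *\<^sub>v g s \<in> carrier_vec p"
    using ev by eventually_elim auto
  ultimately show ?thesis using assms by (auto simp: mat_tendsto_def vec_tendsto_def)
qed

lemma mat_tendsto_add:
  assumes "mat_tendsto f L p m F" "mat_tendsto g K p m F"
  shows "mat_tendsto (\<lambda>s. f s + g s) (L + K) p m F"
proof -
  have ev: "\<forall>\<^sub>F s in F. f s \<in> carrier_mat p m \<and> g s \<in> carrier_mat p m"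
    using assms by (auto simp: mat_tendsto_def intro: eventually_conj)
  have "((\<lambda>s. (f s + g s) $$ (i, j)) \<longlongrightarrow> (L + K) $$ (i, j)) F" if "i < p" "j < m" for i j
  proof -
    have "((\<lambda>s. f s $$ (i, j) + g s $$ (i, j)) \<longlongrightarrow> L $$ (i, j) + K $$ (i, j)) F"
      using assms that by (intro tendsto_intros) (auto simp: mat_tendsto_def)
    moreover have "\<forall>\<^sub>F s in F. f s $$ (i, j) + g s $$ (i, j) = (f s + g s) $$ (i, j)"
      using ev by eventually_elim (use that in auto)
    moreover have "L $$ (i, j) + K $$ (i, j) = (L + K) $$ (i, j)"
      using that assms by (auto simp: mat_tendsto_def)
    ultimately show ?thesis by (auto elim: Lim_transform_eventually)
  qed
  moreover have "\<forall>\<^sub>F s in F. f s + g s \<in> carrier_mat p m"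
    using ev by eventually_elim auto
  ultimately show ?thesis using assms by (auto simp: mat_tendsto_def)
qed

lemma vec_tendsto_add:
  assumes "vec_tendsto f L p F" "vec_tendsto g K p F"
  shows "vec_tendsto (\<lambda>s. f s + g s) (L + K) p F"
proof -
  have ev: "\<forall>\<^sub>F s in F. f s \<in> carrier_vec p \<and> g s \<in> carrier_vec p"
    using assms by (auto simp: vec_tendsto_def intro: eventually_conj)
  have "((\<lambda>s. (f s + g s) $ i) \<longlongrightarrow> (L + K) $ i) F" if "i < p" for i
  proof -
    have "((\<lambda>s. f s $ i + g s $ i) \<longlongrightarrow> L $ i + K $ i) F"
      using assms that by (intro tendsto_intros) (auto simp: vec_tendsto_def)
    moreover have "\<forall>\<^sub>F s in F. f s $ i + g s $ i = (f s + g s) $ i"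
      using ev by eventually_elim (use that in auto)
    moreover have "L $ i + K $ i = (L + K) $ i"
      using that assms by (auto simp: vec_tendsto_def)
    ultimately show ?thesis by (auto elim: Lim_transform_eventually)
  qed
  moreover have "\<forall>\<^sub>F s in F. f s + g s \<in> carrier_vec p"
    using ev by eventually_elim auto
  ultimately show ?thesis using assms by (auto simp: vec_tendsto_def)
qed

lemma vec_tendsto_minus:
  assumes "vec_tendsto f L p F" "vec_tendsto g K p F"
  shows "vec_tendsto (\<lambda>s. f s - g s) (L - K) p F"
proof -
  have ev: "\<forall>\<^sub>F s in F. f s \<in> carrier_vec p \<and> g s \<in> carrier_vec p"
    using assms by (auto simp: vec_tendsto_def intro: eventually_conj)
  have "((\<lambda>s. (f s - g s) $ i) \<longlongrightarrow> (L - K) $ i) F" if "i < p" for i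
  proof -
    have "((\<lambda>s. f s $ i - g s $ i) \<longlongrightarrow> L $ i - K $ i) F"
      using assms that by (intro tendsto_intros) (auto simp: vec_tendsto_def)
    moreover have "\<forall>\<^sub>F s in F. f s $ i - g s $ i = (f s - g s) $ i"
      using ev by eventually_elim (use that in auto)
    moreover have "L $ i - K $ i = (L - K) $ i"
      using that assms by (auto simp: vec_tendsto_def)
    ultimately show ?thesis by (auto elim: Lim_transform_eventually)
  qed
  moreover have "\<forall>\<^sub>F s in F. f s - g s \<in> carrier_vec p"
    using ev by eventually_elim auto
  ultimately show ?thesis using assms by (auto simp: vec_tendsto_def)
qed

lemma mat_tendsto_smult:
  assumes "(c \<longlongrightarrow> a) F" "mat_tendsto f L p m F"
  shows "mat_tendsto (\<lambda>s. c s \<cdot>\<^sub>m f s) (a \<cdot>\<^sub>m L) p m F"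
proof -
  have ev: "\<forall>\<^sub>F s in F. f s \<in> carrier_mat p m"
    using assms by (auto simp: mat_tendsto_def)
  have "((\<lambda>s. (c s \<cdot>\<^sub>m f s) $$ (i, j)) \<longlongrightarrow> (a \<cdot>\<^sub>m L) $$ (i, j)) F" if "i < p" "j < m" for i j
  proof -
    have "((\<lambda>s. c s * f s $$ (i, j)) \<longlongrightarrow> a * L $$ (i, j)) F"
      using assms that by (intro tendsto_intros) (auto simp: mat_tendsto_def)
    moreover have "\<forall>\<^sub>F s in F. c s * f s $$ (i, j) = (c s \<cdot>\<^sub>m f s) $$ (i, j)"
      using ev by eventually_elim (use that in auto)
    moreover have "a * L $$ (i, j) = (a \<cdot>\<^sub>m L) $$ (i, j)"
      using that assms by (auto simp: mat_tendsto_def)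
    ultimately show ?thesis by (auto elim: Lim_transform_eventually)
  qed
  moreover have "\<forall>\<^sub>F s in F. c s \<cdot>\<^sub>m f s \<in> carrier_mat p m"
    using ev by eventually_elim auto
  ultimately show ?thesis using assms by (auto simp: mat_tendsto_def)
qed

text \<open>A bounded factor times a null factor is null. In this way the functions
  \<open>N\<close>, \<open>X\<close>, \<open>Y\<close> are handled at imaginary points, where they
  need not have limits.\<close>

lemma mat_tendsto_bounded_zero:
  assumes "\<forall>\<^sub>F s in F. f s \<in> carrier_mat p n"
    and "\<And>i j. i < p \<Longrightarrow> j < n \<Longrightarrow> \<exists>K. \<forall>\<^sub>F s in F. norm (f s $$ (i, j)) \<le> K"
    and "vec_tendsto g (0\<^sub>v n) n F"
  shows "vec_tendsto (\<lambda>s. f s *\<^sub>v g s) (0\<^sub>v p) p F"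
proof -
  have ev: "\<forall>\<^sub>F s in F. f s \<in> carrier_mat p n \<and> g s \<in> carrier_vec n"
    using assms by (auto simp: vec_tendsto_def intro: eventually_conj)
  have "((\<lambda>s. (f s *\<^sub>v g s) $ i) \<longlongrightarrow> 0\<^sub>v p $ i) F" if "i < p" for i
  proof -
    have "((\<lambda>s. \<Sum>k<n. f s $$ (i, k) * g s $ k) \<longlongrightarrow> (\<Sum>k<n. 0)) F"
    proof (rule tendsto_sum)
      fix k assume k: "k \<in> {..<n}"
      obtain K where K: "\<forall>\<^sub>F s in F. norm (f s $$ (i, k)) \<le> K"
        using assms(2)[of i k] \<open>i < p\<close> k by auto
      have "((\<lambda>s. g s $ k) \<longlongrightarrow> 0) F" using assms(3) k by (auto simp: vec_tendsto_def)
      then show "((\<lambda>s. f s $$ (i, k) * g s $ k) \<longlongrightarrow> 0) F"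
        by (rule lim_null_mult_left_bounded[OF K])
    qed
    moreover have "\<forall>\<^sub>F s in F. (\<Sum>k<n. f s $$ (i, k) * g s $ k) = (f s *\<^sub>v g s) $ i"
      using ev by eventually_elim (use that in \<open>auto simp: scalar_prod_def atLeast0LessThan\<close>)
    ultimately show ?thesis using that by (auto elim: Lim_transform_eventually)
  qed
  moreover have "\<forall>\<^sub>F s in F. f s *\<^sub>v g s \<in> carrier_vec p"
    using ev by eventually_elim auto
  ultimately show ?thesis using assms by (auto simp: vec_tendsto_def)
qed

section \<open>Continuity of determinant, adjugate and inverse\<close>

lemma tendsto_det:
  assumes "mat_tendsto f L n n F"
  shows "((\<lambda>s. det (f s)) \<longlongrightarrow> det L) F"
proof -
  let ?d = "\<lambda>A :: complex mat. \<Sum>q | q permutes {0..<n}. signof q * (\<Prod>i = 0..<n. A $$ (i, q i))"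
  have "((\<lambda>s. ?d (f s)) \<longlongrightarrow> ?d L) F"
    using assms by (intro tendsto_intros) (auto simp: mat_tendsto_def permutes_in_image)
  moreover have "\<forall>\<^sub>F s in F. f s \<in> carrier_mat n n" using assms by (simp add: mat_tendsto_def)
  then have "\<forall>\<^sub>F s in F. ?d (f s) = det (f s)"
    by eventually_elim (simp add: det_def')
  moreover have "det L = ?d L" using assms by (simp add: det_def' mat_tendsto_def)
  ultimately show ?thesis by (auto elim: Lim_transform_eventually)
qed

lemma mat_tendsto_adj:
  assumes "mat_tendsto f L n n F"
  shows "mat_tendsto (\<lambda>s. adj_mat (f s)) (adj_mat L) n n F"
proof -
  have ev: "\<forall>\<^sub>F s in F. f s \<in> carrier_mat n n" and L: "L \<in> carrier_mat n n"
    using assms by (simp_all add: mat_tendsto_def)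
  have "((\<lambda>s. adj_mat (f s) $$ (i, j)) \<longlongrightarrow> adj_mat L $$ (i, j)) F" if ij: "i < n" "j < n" for i j
  proof -
    have "mat_tendsto (\<lambda>s. mat_delete (f s) j i) (mat_delete L j i) (n - 1) (n - 1) F"
    proof -
      have "\<forall>\<^sub>F s in F. mat_delete (f s) j i \<in> carrier_mat (n - 1) (n - 1)"
        using ev by eventually_elim (auto simp: mat_delete_def)
      moreover have "((\<lambda>s. mat_delete (f s) j i $$ (a, b)) \<longlongrightarrow> mat_delete L j i $$ (a, b)) F"
        if ab: "a < n - 1" "b < n - 1" for a b
      proof -
        \<comment> \<open>Deleting row \<open>j\<close> and column \<open>i\<close> shifts every
          index from the deleted one onwards by one.\<close>
        have "((\<lambda>s. f s $$ (if a < j then a else Suc a, if b < i then b else Suc b))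
          \<longlongrightarrow> L $$ (if a < j then a else Suc a, if b < i then b else Suc b)) F"
          using assms ab by (auto simp: mat_tendsto_def)
        moreover have "\<forall>\<^sub>F s in F. f s $$ (if a < j then a else Suc a, if b < i then b else Suc b)
           = mat_delete (f s) j i $$ (a, b)"
          using ev by eventually_elim (use ab in \<open>auto simp: mat_delete_def\<close>)
        ultimately show ?thesis
          using L ab by (auto simp: mat_delete_def elim: Lim_transform_eventually)
      qed
      ultimately show ?thesis using L by (auto simp: mat_tendsto_def mat_delete_def)
    qed
    then have "((\<lambda>s. cofactor (f s) j i) \<longlongrightarrow> cofactor L j i) F"
      unfolding cofactor_def by (intro tendsto_intros tendsto_det)
    moreover have "\<forall>\<^sub>F s in F. cofactor (f s) j i = adj_mat (f s) $$ (i, j)"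
      using ev by eventually_elim (use ij in \<open>auto simp: adj_mat_def\<close>)
    ultimately show ?thesis using L ij by (auto simp: adj_mat_def elim: Lim_transform_eventually)
  qed
  moreover have "\<forall>\<^sub>F s in F. adj_mat (f s) \<in> carrier_mat n n"
    using ev by eventually_elim (simp add: adj_mat)
  ultimately show ?thesis using adj_mat(1)[OF L] by (auto simp: mat_tendsto_def)
qed

text \<open>The adjugate formula reduces this to continuity of determinant and adjugate. The first
  conclusion guarantees that the \<open>mat_inv\<close> in the second is a true inverse near the
  limit.\<close>

lemma mat_tendsto_inv:
  assumes "mat_tendsto f L n n F" "det L \<noteq> 0"
  shows "\<forall>\<^sub>F s in F. det (f s) \<noteq> 0" "mat_tendsto (\<lambda>s. mat_inv (f s)) (mat_inv L) n n F"
proof -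
  show ev: "\<forall>\<^sub>F s in F. det (f s) \<noteq> 0"
    using tendsto_imp_eventually_ne[OF tendsto_det[OF assms(1)] assms(2)] .
  have "mat_tendsto (\<lambda>s. inverse (det (f s)) \<cdot>\<^sub>m adj_mat (f s)) (inverse (det L) \<cdot>\<^sub>m adj_mat L) n n F"
    by (intro mat_tendsto_smult mat_tendsto_adj tendsto_inverse tendsto_det[OF assms(1)] assms)
  moreover have ec: "\<forall>\<^sub>F s in F. f s \<in> carrier_mat n n" and L: "L \<in> carrier_mat n n"
    using assms by (simp_all add: mat_tendsto_def)
  have "\<forall>\<^sub>F s in F. mat_inv (f s) = inverse (det (f s)) \<cdot>\<^sub>m adj_mat (f s)"
    using ev ec by eventually_elim (rule mat_inv_adj)
  ultimately show "mat_tendsto (\<lambda>s. mat_inv (f s)) (mat_inv L) n n F"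
    unfolding mat_inv_adj[OF L assms(2)] by (rule mat_tendsto_cong)
qed

lemma mat_tendsto_resolvent_arg:
  assumes "A \<in> carrier_mat n n"
  shows "mat_tendsto (\<lambda>s. s \<cdot>\<^sub>m 1\<^sub>m n - A) (l \<cdot>\<^sub>m 1\<^sub>m n - A) n n (at l within S)"
  using assms unfolding mat_tendsto_def
  by (auto simp: minus_carrier_mat intro!: tendsto_eq_intros)

subsection \<open>Minimal realizations\<close>

lemma snd_quot_of_fract_complex_nonzero:
  "map_poly (of_real :: real \<Rightarrow> complex) (snd (quot_of_fract f)) \<noteq> 0"
  using snd_quot_of_fract_nonzero[of f] by (subst map_poly_eq_0_iff) auto

lemma finite_tf_poles: "finite {s. tf_pole G s}"
proof -
  have "{s. tf_pole G s} = (\<Union>j<dim_row G. \<Union>k<dim_col G. {s. fract_pole (G $$ (j, k)) s})"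
    by (auto simp: tf_pole_def)
  then show ?thesis
    unfolding fract_pole_def using poly_roots_finite[OF snd_quot_of_fract_complex_nonzero] by auto
qed

text \<open>The determinant is the value at \<open>s\<close> of the characteristic polynomial of
  \<open>A\<close>, which is monic and hence nonzero.\<close>

lemma finite_resolvent_poles:
  assumes "A \<in> carrier_mat n n"
  shows "finite {s :: complex. det (s \<cdot>\<^sub>m 1\<^sub>m n - A) = 0}"
proof -
  have "char_poly A \<noteq> 0"
    using degree_monic_char_poly[OF assms] by (metis coeff_0 zero_neq_one)
  moreover have "poly (char_poly A) s = det (s \<cdot>\<^sub>m 1\<^sub>m n - A)" for s
    unfolding char_poly_def
    by (rule poly_det_cong[of _ n])
      (use assms in \<open>auto simp: char_poly_matrix_def\<close>)
  ultimately show ?thesis using poly_roots_finite[of "char_poly A"] by simp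
qed

lemma eventually_at_not_in_finite:
  fixes l :: "'a :: t1_space"
  assumes "finite S"
  shows "\<forall>\<^sub>F s in at l within T. s \<notin> S"
  unfolding eventually_at_topological
proof (intro exI conjI)
  \<comment> \<open>The point \<open>l\<close> stays in the neighbourhood even if it lies in
    \<open>S\<close>, since \<open>at l\<close> ignores it.\<close>
  show "open (- (S - {l}))" using assms by (intro open_Compl finite_imp_closed) simp
qed auto

lemma tendsto_tf_eval:
  assumes "\<not> tf_pole G l"
  shows "mat_tendsto (tf_eval G) (tf_eval G l) (dim_row G) (dim_col G) (at l)"
  using assms unfolding mat_tendsto_def tf_eval_def
  by (auto simp: tf_pole_def fract_eval_def fract_pole_def intro!: tendsto_intros)

section \<open>Reducing the state dimension\<close>

text \<open>The relations say that the range of \<open>T\<close> is \<open>A\<close>-invariant and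
  contains the range of \<open>B\<close>. From \<open>(sI - A) T = T (sI - A')\<close> it follows
  that \<open>T (sI - A')^-1 B'\<close> solves the resolvent equation of \<open>A\<close> with right
  side \<open>B\<close>, so the transfer function is unchanged.\<close>

lemma realization_restrict:
  assumes R: "realization G A B C D" and n: "n = dim_row A"
    and T: "T \<in> carrier_mat n r" and A': "A' \<in> carrier_mat r r"
    and B': "B' \<in> carrier_mat r (dim_col G)"
    and AT: "A * T = T * A'" and BT: "B = T * B'"
  shows "realization G A' B' (C * T) D"
proof -
  let ?p = "dim_row G" and ?m = "dim_col G"
  have A: "A \<in> carrier_mat n n" and B: "B \<in> carrier_mat n ?m" and C: "C \<in> carrier_mat ?p n"
    and D: "D \<in> carrier_mat ?p ?m"
    and eq: "\<And>s. det (s \<cdot>\<^sub>m 1\<^sub>m n - A) \<noteq> 0 \<Longrightarrow> \<not> tf_pole G s \<Longrightarrow>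
       tf_eval G s = D + C * mat_inv (s \<cdot>\<^sub>m 1\<^sub>m n - A) * B"
    using R by (auto simp: realization_def n)
  have "tf_eval G l = D + C * T * mat_inv (l \<cdot>\<^sub>m 1\<^sub>m r - A') * B'"
    if l: "det (l \<cdot>\<^sub>m 1\<^sub>m r - A') \<noteq> 0" "\<not> tf_pole G l" for l
  proof -
    \<comment> \<open>The identity is demanded also at eigenvalues \<open>l\<close> of
      \<open>A\<close>, where the given realization says nothing. Both sides are continuous at
      \<open>l\<close>, so comparing them at generic nearby points suffices.\<close>
    have lim: "mat_tendsto (\<lambda>s. D + C * T * mat_inv (s \<cdot>\<^sub>m 1\<^sub>m r - A') * B')
        (D + C * T * mat_inv (l \<cdot>\<^sub>m 1\<^sub>m r - A') * B') ?p ?m (at l)"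
      using D C T B'
      by (intro mat_tendsto_add mat_tendsto_mult[where n = r] mat_tendsto_const mat_tendsto_inv(2)
          mat_tendsto_resolvent_arg A' l(1)) auto
    have "\<forall>\<^sub>F s in at l. s \<notin> {s. tf_pole G s} \<and> s \<notin> {s. det (s \<cdot>\<^sub>m 1\<^sub>m n - A) = 0}
        \<and> s \<notin> {s. det (s \<cdot>\<^sub>m 1\<^sub>m r - A') = 0}"
      by (intro eventually_conj eventually_at_not_in_finite finite_tf_poles
          finite_resolvent_poles A A')
    then have "\<forall>\<^sub>F s in at l. tf_eval G s = D + C * T * mat_inv (s \<cdot>\<^sub>m 1\<^sub>m r - A') * B'"
    proof eventually_elim
      case (elim s)
      let ?R' = "s \<cdot>\<^sub>m 1\<^sub>m r - A'" and ?R = "s \<cdot>\<^sub>m 1\<^sub>m n - A"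
      have R': "?R' \<in> carrier_mat r r" and Rc: "?R \<in> carrier_mat n n"
        using A A' by (auto simp: minus_carrier_mat)
      have inv: "mat_inv ?R' \<in> carrier_mat r r" "?R' * mat_inv ?R' = 1\<^sub>m r"
        using mat_inv[OF R'] elim by auto
      have "?R * T = s \<cdot>\<^sub>m T - A * T"
        using A T by (subst minus_mult_distrib_mat[of _ n n]) (auto simp: mult_smult_assoc_mat[of _ n n])
      also have "\<dots> = T * ?R'"
        using A' T by (subst mult_minus_distrib_mat[of _ n r _ r])
          (auto simp: mult_smult_distrib[of _ n r] AT)
      finally have RT: "?R * T = T * ?R'" .
      have "?R * (T * (mat_inv ?R' * B')) = (?R * T) * (mat_inv ?R' * B')"
        by (rule assoc_mult_mat[symmetric, of _ n n _ r _ ?m]) (use Rc T inv B' in auto)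
      also have "\<dots> = T * (?R' * (mat_inv ?R' * B'))"
        unfolding RT by (rule assoc_mult_mat[of _ n r _ r _ ?m]) (use R' T inv B' in auto)
      also have "?R' * (mat_inv ?R' * B') = B'"
        using R' inv B' by (simp flip: assoc_mult_mat[of _ r r _ r _ ?m])
      finally have "mat_inv ?R * B = T * (mat_inv ?R' * B')"
        using Rc elim T inv B' BT by (intro mat_inv_mult_eqI[of _ n _ ?m]) auto
      moreover have "C * mat_inv ?R * B = C * (mat_inv ?R * B)"
        by (rule assoc_mult_mat[of _ ?p n _ n _ ?m]) (use C B mat_inv[OF Rc] elim in auto)
      moreover have "C * T * mat_inv ?R' * B' = C * (T * (mat_inv ?R' * B'))"
      proof -
        have "C * T * mat_inv ?R' * B' = C * T * (mat_inv ?R' * B')"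
          by (rule assoc_mult_mat[of _ ?p r _ r _ ?m]) (use C T inv B' in auto)
        also have "\<dots> = C * (T * (mat_inv ?R' * B'))"
          by (rule assoc_mult_mat[of _ ?p n _ r _ ?m]) (use C T inv B' in auto)
        finally show ?thesis .
      qed
      ultimately show ?case using eq[of s] elim by simp
    qed
    then have "mat_tendsto (tf_eval G) (D + C * T * mat_inv (l \<cdot>\<^sub>m 1\<^sub>m r - A') * B') ?p ?m (at l)"
      by (rule mat_tendsto_cong[OF lim])
    then show ?thesis
      by (intro mat_tendsto_unique[OF at_neq_bot tendsto_tf_eval[OF l(2)]])
  qed
  then show ?thesis using A' B' C T D by (auto simp: realization_def)
qed

text \<open>Such a \<open>w\<close> is a left eigenvector of \<open>A\<close> that annihilates the
  columns of \<open>B\<close>. The kernel of the row \<open>w\<close> is then an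
  \<open>A\<close>-invariant subspace of dimension \<open>n - 1\<close> containing the range of
  \<open>B\<close>, and restricting the system to it gives a smaller realization.\<close>

lemma minimal_realization_no_left_null:
  assumes min: "minimal_realization G A B C D" and n: "n = dim_row A"
    and w: "w \<in> carrier_vec n" "w \<noteq> 0\<^sub>v n" "(l \<cdot>\<^sub>m 1\<^sub>m n - A)\<^sup>T *\<^sub>v w = 0\<^sub>v n"
      "B\<^sup>T *\<^sub>v w = 0\<^sub>v (dim_col G)"
  shows False
proof -
  let ?m = "dim_col G"
  have R: "realization G A B C D" and
    le: "\<And>A' B' C' D'. realization G A' B' C' D' \<Longrightarrow> n \<le> dim_row A'"
    using min by (auto simp: minimal_realization_def n)
  have A: "A \<in> carrier_mat n n" and B: "B \<in> carrier_mat n ?m"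
    using R by (auto simp: realization_def n)
  \<comment> \<open>The index \<open>k\<close> is the pivot for completing \<open>w\<close> to a
    basis. It also shows \<open>n > 0\<close>, so that \<open>n - 1\<close> is a true
    predecessor.\<close>
  obtain k where k: "k < n" "w $ k \<noteq> 0"
    using w(1,2) by (metis carrier_vecD eq_vecI index_zero_vec)
  define r where "r = n - 1"
  have nr: "n = Suc r" using k by (simp add: r_def)
  have wA: "(\<Sum>c<n. w $ c * A $$ (c, b)) = l * w $ b" if b: "b < n" for b
  proof -
    have "0 = ((l \<cdot>\<^sub>m 1\<^sub>m n - A)\<^sup>T *\<^sub>v w) $ b" using w b by simp
    also have "\<dots> = (\<Sum>c<n. (l * (if c = b then 1 else 0) - A $$ (c, b)) * w $ c)"
      using A b w(1) by (auto simp: scalar_prod_def atLeast0LessThan intro!: sum.cong)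
    also have "\<dots> = (\<Sum>c<n. if c = b then l * w $ b else 0) - (\<Sum>c<n. w $ c * A $$ (c, b))"
      unfolding sum_subtractf[symmetric] by (intro sum.cong) (auto simp: algebra_simps)
    finally show ?thesis using b by simp
  qed
  have wB: "(\<Sum>c<n. w $ c * B $$ (c, b)) = 0" if b: "b < ?m" for b
  proof -
    have "0 = (B\<^sup>T *\<^sub>v w) $ b" using w b by simp
    also have "\<dots> = (\<Sum>c<n. w $ c * B $$ (c, b))"
      using B b w(1) by (auto simp: scalar_prod_def atLeast0LessThan mult.commute intro!: sum.cong)
    finally show ?thesis by simp
  qed
  \<comment> \<open>The row \<open>w\<close> is completed by all unit rows except the one at
    \<open>k\<close>. The unit row displaced from position 0 by \<open>w\<close> goes to position
    \<open>k\<close>.\<close>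
  define S where "S = mat n n (\<lambda>(i, j). if i = 0 then w $ j
      else if i = k then (if j = 0 then 1 else 0) else (if j = i then 1 else 0))"
  have S: "S \<in> carrier_mat n n" by (simp add: S_def)
  have "det S \<noteq> 0"
  proof
    assume "det S = 0"
    then obtain x where x: "x \<in> carrier_vec n" "x \<noteq> 0\<^sub>v n" "S *\<^sub>v x = 0\<^sub>v n"
      using det_0_iff_vec_prod_zero[OF S] by auto
    have row: "(\<Sum>j<n. S $$ (i, j) * x $ j) = 0" if "i < n" for i
    proof -
      have "(S *\<^sub>v x) $ i = 0" using x that by simp
      then show ?thesis using S x(1) that by (simp add: scalar_prod_def atLeast0LessThan)
    qed
    \<comment> \<open>The unit rows kill every coordinate except the one at \<open>k\<close>; row 0
      then leaves \<open>w $ k * x $ k = 0\<close>.\<close>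
    have z: "x $ b = 0" if b: "b < n" "b \<noteq> k" for b
    proof (cases "b = 0")
      case True
      then have "(\<Sum>j<n. if j = 0 then x $ j else 0) = 0"
        using row[OF k(1)] k(1) b by (simp add: S_def if_distrib[of "\<lambda>a. a * _"] cong: if_cong)
      then show ?thesis using True nr by (simp split: if_splits)
    next
      case False
      then have "(\<Sum>j<n. if j = b then x $ j else 0) = 0"
        using row[OF b(1)] b by (simp add: S_def if_distrib[of "\<lambda>a. a * _"] cong: if_cong)
      then show ?thesis using b by simp
    qed
    have "(\<Sum>j<n. S $$ (0, j) * x $ j) = (\<Sum>j<n. if j = k then w $ k * x $ k else 0)"
      by (intro sum.cong) (use z nr in \<open>auto simp: S_def\<close>)
    also have "\<dots> = w $ k * x $ k" using k(1) by simp
    finally have "w $ k * x $ k = 0" using row[of 0] k(1) by simp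
    then have "x $ k = 0" using k by simp
    with z have "x = 0\<^sub>v n" using x(1) by (intro eq_vecI) auto
    with x show False by simp
  qed
  note Si = mat_inv[OF S this]
  define R where "R = mat_inv S"
  \<comment> \<open>With \<open>R\<close> the inverse of \<open>S\<close>, \<open>Q\<close> is the
    first column of \<open>R\<close> times the row \<open>w\<close>, \<open>T\<close> consists of
    the other columns of \<open>R\<close>, and \<open>L\<close> of the other rows of
    \<open>S\<close>. Splitting off the first summand in \<open>R * S = 1\<close> gives
    \<open>Q + T * L = 1\<close>.\<close>
  define Q where "Q = mat n n (\<lambda>(a, b). R $$ (a, 0) * w $ b)"
  define T where "T = mat n r (\<lambda>(i, j). R $$ (i, Suc j))"
  define L where "L = mat r n (\<lambda>(i, j). S $$ (Suc i, j))"
  have c: "R \<in> carrier_mat n n" "Q \<in> carrier_mat n n" "T \<in> carrier_mat n r" "L \<in> carrier_mat r n"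
    using Si(1) by (auto simp: R_def Q_def T_def L_def)
  have QTL: "Q + T * L = 1\<^sub>m n"
  proof (rule eq_matI)
    fix a b assume "a < dim_row (1\<^sub>m n :: complex mat)" "b < dim_col (1\<^sub>m n :: complex mat)"
    then have ab: "a < n" "b < n" by auto
    have "(1\<^sub>m n :: complex mat) $$ (a, b) = (R * S) $$ (a, b)" using Si(3) by (simp add: R_def)
    also have "\<dots> = (\<Sum>c<n. R $$ (a, c) * S $$ (c, b))"
      using c(1) S ab by (simp add: scalar_prod_def atLeast0LessThan)
    also have "\<dots> = R $$ (a, 0) * S $$ (0, b) + (\<Sum>c<r. R $$ (a, Suc c) * S $$ (Suc c, b))"
      unfolding nr sum.lessThan_Suc_shift by simp
    also have "S $$ (0, b) = w $ b" using ab nr by (simp add: S_def)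
    also have "R $$ (a, 0) * w $ b + (\<Sum>c<r. R $$ (a, Suc c) * S $$ (Suc c, b)) = (Q + T * L) $$ (a, b)"
      using c ab by (simp add: scalar_prod_def atLeast0LessThan) (simp add: Q_def T_def L_def)
    finally show "(Q + T * L) $$ (a, b) = (1\<^sub>m n) $$ (a, b)" by simp
  qed (use c in auto)
  \<comment> \<open>Row 0 of \<open>S * R = 1\<close> says that \<open>w\<close> annihilates every
    column of \<open>T\<close>.\<close>
  have QT: "Q * T = 0\<^sub>m n r"
  proof (rule eq_matI)
    fix a j assume "a < dim_row (0\<^sub>m n r :: complex mat)" "j < dim_col (0\<^sub>m n r :: complex mat)"
    then have aj: "a < n" "j < r" by auto
    have "(\<Sum>b<n. w $ b * R $$ (b, Suc j)) = (S * R) $$ (0, Suc j)"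
      using c(1) S aj nr by (simp add: scalar_prod_def atLeast0LessThan) (simp add: S_def)
    also have "\<dots> = 0" using Si(2) aj nr by (simp add: R_def)
    finally have "R $$ (a, 0) * (\<Sum>b<n. w $ b * R $$ (b, Suc j)) = 0" by simp
    then show "(Q * T) $$ (a, j) = 0\<^sub>m n r $$ (a, j)"
      using c aj by (simp add: scalar_prod_def atLeast0LessThan sum_distrib_left)
        (simp add: Q_def T_def mult.assoc)
  qed (use c in auto)
  have QA: "Q * A = l \<cdot>\<^sub>m Q"
  proof (rule eq_matI)
    fix a b assume "a < dim_row (l \<cdot>\<^sub>m Q)" "b < dim_col (l \<cdot>\<^sub>m Q)"
    then have ab: "a < n" "b < n" using c by auto
    have "(Q * A) $$ (a, b) = R $$ (a, 0) * (\<Sum>d<n. w $ d * A $$ (d, b))"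
      using c A ab by (simp add: scalar_prod_def atLeast0LessThan sum_distrib_left)
        (simp add: Q_def mult.assoc)
    then show "(Q * A) $$ (a, b) = (l \<cdot>\<^sub>m Q) $$ (a, b)" using ab by (simp add: wA Q_def)
  qed (use c A in auto)
  have QB: "Q * B = 0\<^sub>m n ?m"
  proof (rule eq_matI)
    fix a b assume "a < dim_row (0\<^sub>m n ?m :: complex mat)" "b < dim_col (0\<^sub>m n ?m :: complex mat)"
    then have ab: "a < n" "b < ?m" by auto
    have "(Q * B) $$ (a, b) = R $$ (a, 0) * (\<Sum>d<n. w $ d * B $$ (d, b))"
      using c B ab by (simp add: scalar_prod_def atLeast0LessThan sum_distrib_left)
        (simp add: Q_def mult.assoc)
    then show "(Q * B) $$ (a, b) = (0\<^sub>m n ?m) $$ (a, b)" using ab by (simp add: wB)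
  qed (use c B in auto)
  \<comment> \<open>Hence \<open>Q * X = 0\<close> means that the columns of \<open>X\<close> lie in
    the range of \<open>T\<close>, with coordinates \<open>L * X\<close>. This is applied to
    \<open>A * T\<close>, where \<open>Q * A * T = l Q * T = 0\<close>, and to
    \<open>B\<close>.\<close>
  have split: "X = Q * X + T * (L * X)" if X: "X \<in> carrier_mat n q" for X q
  proof -
    have "X = (Q + T * L) * X" using QTL X by simp
    also have "\<dots> = Q * X + T * L * X"
      by (rule add_mult_distrib_mat[of _ n n _ _ q]) (use c X in auto)
    also have "T * L * X = T * (L * X)"
      by (rule assoc_mult_mat[of _ n r _ n _ q]) (use c X in auto)
    finally show ?thesis .
  qed
  have "A * T = Q * (A * T) + T * (L * (A * T))"
    by (rule split[of _ r]) (use A c in auto)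
  also have "Q * (A * T) = (Q * A) * T"
    by (rule assoc_mult_mat[symmetric, of _ n n _ n _ r]) (use A c in auto)
  also have "\<dots> = 0\<^sub>m n r"
    unfolding QA using c by (simp add: mult_smult_assoc_mat[of _ n n _ r] QT)
  finally have AT: "A * T = T * (L * (A * T))" using c A by (simp add: left_add_zero_mat[of _ n r])
  have BT: "B = T * (L * B)" using split[OF B] c B by (simp add: QB left_add_zero_mat[of _ n ?m])
  \<comment> \<open>The restricted system has \<open>r = n - 1\<close> states, contrary to
    minimality.\<close>
  have "realization G (L * (A * T)) (L * B) (C * T) D"
    using c A B AT BT by (intro realization_restrict[OF \<open>realization G A B C D\<close> n, of _ r]) auto
  then have "n \<le> r" using le[of "L * (A * T)"] c by simp
  then show False using nr by simp
qed

text \<open>The left inverse comes from the Gram matrix \<open>F\<^sup>* F + C\<^sup>* C\<close>, which is invertible.\<close>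

lemma stacked_left_inverse:
  fixes F C :: "complex mat"
  assumes F: "F \<in> carrier_mat n n" and C: "C \<in> carrier_mat p n"
    and inj: "\<And>v. v \<in> carrier_vec n \<Longrightarrow> F *\<^sub>v v = 0\<^sub>v n \<Longrightarrow> C *\<^sub>v v = 0\<^sub>v p \<Longrightarrow> v = 0\<^sub>v n"
  obtains K L where "K \<in> carrier_mat n n" "L \<in> carrier_mat n p" "K * F + L * C = 1\<^sub>m n"
proof -
  define F' where "F' = (map_mat cnj F)\<^sup>T"
  define C' where "C' = (map_mat cnj C)\<^sup>T"
  have c: "F' \<in> carrier_mat n n" "C' \<in> carrier_mat n p" using F C by (auto simp: F'_def C'_def)
  define H where "H = F' * F + C' * C"
  have H: "H \<in> carrier_mat n n" using c F C by (auto simp: H_def)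
  have adj: "((map_mat cnj X)\<^sup>T *\<^sub>v (X *\<^sub>v v)) \<bullet> conjugate v = (X *\<^sub>v v) \<bullet>c (X *\<^sub>v v)"
    if X: "X \<in> carrier_mat q n" and v: "v \<in> carrier_vec n" for X q and v :: "complex vec"
  proof -
    have "map_mat cnj X *\<^sub>v conjugate v = conjugate (X *\<^sub>v v)"
      using X v by (intro eq_vecI) (auto simp: scalar_prod_def sum_conjugate)
    then show ?thesis
      using X v by (subst transpose_vec_mult_scalar[of _ q n]) auto
  qed
  have "det H \<noteq> 0"
  proof
    assume "det H = 0"
    then obtain v where v: "v \<in> carrier_vec n" "v \<noteq> 0\<^sub>v n" "H *\<^sub>v v = 0\<^sub>v n"
      using det_0_iff_vec_prod_zero[OF H] by auto
    have Fv: "F *\<^sub>v v \<in> carrier_vec n" "C *\<^sub>v v \<in> carrier_vec p" using F C v by auto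
    \<comment> \<open>Pairing \<open>H v = 0\<close> with the conjugate of \<open>v\<close> gives
      the sum of the squared norms of \<open>F v\<close> and \<open>C v\<close>; both vanish, and
      \<open>inj\<close> yields \<open>v = 0\<close>.\<close>
    have "0 = (H *\<^sub>v v) \<bullet> conjugate v" using v by simp
    also have "(H *\<^sub>v v) = F' *\<^sub>v (F *\<^sub>v v) + C' *\<^sub>v (C *\<^sub>v v)"
      unfolding H_def using c F C v by (subst add_mult_distrib_mat_vec[of _ n n]) auto
    also have "(F' *\<^sub>v (F *\<^sub>v v) + C' *\<^sub>v (C *\<^sub>v v)) \<bullet> conjugate v = (F *\<^sub>v v) \<bullet>c (F *\<^sub>v v) + (C *\<^sub>v v) \<bullet>c (C *\<^sub>v v)"
      using c F C v adj[OF F v(1)] adj[OF C v(1)] Fv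
      by (subst add_scalar_prod_distrib[of _ n]) (auto simp: F'_def C'_def)
    finally have "(F *\<^sub>v v) \<bullet>c (F *\<^sub>v v) = 0 \<and> (C *\<^sub>v v) \<bullet>c (C *\<^sub>v v) = 0"
      using conjugate_square_ge_0_vec[of "F *\<^sub>v v"] conjugate_square_ge_0_vec[of "C *\<^sub>v v"]
      by (metis add_nonneg_eq_0_iff)
    then show False using inj[of v] v Fv by simp
  qed
  note Hi = mat_inv[OF H this]
  show thesis
  proof (rule that[of "mat_inv H * F'" "mat_inv H * C'"])
    have "mat_inv H * F' * F + mat_inv H * C' * C = mat_inv H * (F' * F) + mat_inv H * (C' * C)"
      using Hi c F C by (simp add: assoc_mult_mat[of _ n n _ n _ n] assoc_mult_mat[of _ n n _ p _ n])
    also have "\<dots> = mat_inv H * H"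
      unfolding H_def by (rule mult_add_distrib_mat[symmetric, of _ n n _ n])
        (use Hi c F C in \<open>auto simp: H_def\<close>)
    finally show "mat_inv H * F' * F + mat_inv H * C' * C = 1\<^sub>m n" using Hi by simp
  qed (use Hi c in auto)
qed

section \<open>Duality under transposition\<close>

lemma tf_pole_transpose: "tf_pole G\<^sup>T s = tf_pole G s"
  unfolding tf_pole_def by (auto; metis index_transpose_mat(1))

lemma tf_eval_transpose: "tf_eval G\<^sup>T s = (tf_eval G s)\<^sup>T"
  by (auto simp: tf_eval_def)

lemma resolvent_arg_transpose:
  fixes A :: "complex mat"
  assumes "A \<in> carrier_mat n n"
  shows "s \<cdot>\<^sub>m 1\<^sub>m n - A\<^sup>T = (s \<cdot>\<^sub>m 1\<^sub>m n - A)\<^sup>T"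
  using assms by (intro eq_matI) auto

text \<open>Transposition reverses the products and exchanges inputs with outputs. It is done
  without conjugation because the adjoint would move the evaluation point from \<open>s\<close> to
  its conjugate.\<close>

lemma realization_transpose:
  assumes "realization G A B C D"
  shows "realization G\<^sup>T A\<^sup>T C\<^sup>T B\<^sup>T D\<^sup>T"
proof -
  let ?p = "dim_row G" and ?m = "dim_col G"
  obtain n where n: "dim_row A = n" by simp
  have A: "A \<in> carrier_mat n n" and B: "B \<in> carrier_mat n ?m" and C: "C \<in> carrier_mat ?p n"
    and D: "D \<in> carrier_mat ?p ?m"
    and eq: "\<And>s. det (s \<cdot>\<^sub>m 1\<^sub>m n - A) \<noteq> 0 \<Longrightarrow> \<not> tf_pole G s \<Longrightarrow>
       tf_eval G s = D + C * mat_inv (s \<cdot>\<^sub>m 1\<^sub>m n - A) * B"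
    using assms unfolding realization_def n by auto
  have "tf_eval G\<^sup>T s = D\<^sup>T + B\<^sup>T * mat_inv (s \<cdot>\<^sub>m 1\<^sub>m n - A\<^sup>T) * C\<^sup>T"
    if s: "det (s \<cdot>\<^sub>m 1\<^sub>m n - A\<^sup>T) \<noteq> 0" "\<not> tf_pole G\<^sup>T s" for s
  proof -
    let ?R = "s \<cdot>\<^sub>m 1\<^sub>m n - A"
    have R: "?R \<in> carrier_mat n n" using A by (rule minus_carrier_mat)
    have d: "det ?R \<noteq> 0" using s(1) det_transpose[OF R] by (simp add: resolvent_arg_transpose[OF A])
    note Ri = mat_inv(1)[OF R d]
    have "tf_eval G\<^sup>T s = (D + C * mat_inv ?R * B)\<^sup>T"
      using eq[OF d] s(2) by (simp add: tf_eval_transpose tf_pole_transpose)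
    also have "\<dots> = D\<^sup>T + (C * mat_inv ?R * B)\<^sup>T"
      by (rule transpose_add[of _ ?p ?m]) (use D C B Ri in auto)
    also have "(C * mat_inv ?R * B)\<^sup>T = B\<^sup>T * (C * mat_inv ?R)\<^sup>T"
      by (rule transpose_mult[of _ ?p n _ ?m]) (use C B Ri in auto)
    also have "(C * mat_inv ?R)\<^sup>T = (mat_inv ?R)\<^sup>T * C\<^sup>T"
      by (rule transpose_mult[of _ ?p n _ n]) (use C Ri in auto)
    also have "B\<^sup>T * ((mat_inv ?R)\<^sup>T * C\<^sup>T) = B\<^sup>T * (mat_inv ?R)\<^sup>T * C\<^sup>T"
      by (rule assoc_mult_mat[symmetric, of _ ?m n _ n _ ?p]) (use C B Ri in auto)
    finally show ?thesis
      by (simp only: resolvent_arg_transpose[OF A] mat_inv_transpose[OF R d])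
  qed
  moreover have "dim_row A\<^sup>T = n" using A by simp
  ultimately show ?thesis using A B C D unfolding realization_def by simp
qed

text \<open>Transposition is an involution that preserves the state dimension, so a smaller
  realization of the transpose would give a smaller one of \<open>G\<close>.\<close>

lemma minimal_realization_transpose:
  assumes "minimal_realization G A B C D"
  shows "minimal_realization G\<^sup>T A\<^sup>T C\<^sup>T B\<^sup>T D\<^sup>T"
  unfolding minimal_realization_def
proof (intro conjI allI impI)
  have R: "realization G A B C D" using assms by (simp add: minimal_realization_def)
  then show "realization G\<^sup>T A\<^sup>T C\<^sup>T B\<^sup>T D\<^sup>T" by (rule realization_transpose)
  fix A' B' C' D' assume R': "realization G\<^sup>T A' B' C' D'"
  have "realization G A'\<^sup>T C'\<^sup>T B'\<^sup>T D'\<^sup>T" using realization_transpose[OF R'] by simp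
  then have "dim_row A \<le> dim_row A'\<^sup>T" using assms unfolding minimal_realization_def by blast
  moreover have "dim_col A = dim_row A"
    by (rule carrier_matD(2)[of _ "dim_row A"]) (use R in \<open>unfold realization_def, blast\<close>)
  moreover have "dim_col A' = dim_row A'"
    by (rule carrier_matD(2)[of _ "dim_row A'"]) (use R' in \<open>unfold realization_def, blast\<close>)
  ultimately show "dim_row A\<^sup>T \<le> dim_row A'" by (simp only: index_transpose_mat)
qed

section \<open>Hautus tests as one-sided inverses\<close>

text \<open>By minimality the transposes of \<open>lI - A\<close> and \<open>B\<close> have no
  common null vector, so stacked on each other they have a left inverse. Its transpose is a right
  inverse of the block row \<open>[lI - A, B]\<close>. This holds at every complex
  \<open>l\<close>.\<close>

lemma minimal_realization_controllable:
  assumes min: "minimal_realization G A B C D" and n: "n = dim_row A" and m: "m = dim_col G"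
  obtains U V where "U \<in> carrier_mat n n" "V \<in> carrier_mat m n"
    "(l \<cdot>\<^sub>m 1\<^sub>m n - A) * U + B * V = 1\<^sub>m n"
proof -
  let ?R = "l \<cdot>\<^sub>m 1\<^sub>m n - A"
  have A: "A \<in> carrier_mat n n" and B: "B \<in> carrier_mat n m"
    using min by (auto simp: minimal_realization_def realization_def n m)
  have R: "?R \<in> carrier_mat n n" using A by (rule minus_carrier_mat)
  have "v = 0\<^sub>v n" if "v \<in> carrier_vec n" "?R\<^sup>T *\<^sub>v v = 0\<^sub>v n" "B\<^sup>T *\<^sub>v v = 0\<^sub>v m" for v
    using minimal_realization_no_left_null[OF min n that(1) _ that(2)] that(3) m by auto
  then obtain K L where KL: "K \<in> carrier_mat n n" "L \<in> carrier_mat n m" "K * ?R\<^sup>T + L * B\<^sup>T = 1\<^sub>m n"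
    using stacked_left_inverse[of "?R\<^sup>T" n "B\<^sup>T" m] R B by (metis transpose_carrier_mat)
  have "?R * K\<^sup>T + B * L\<^sup>T = (K * ?R\<^sup>T + L * B\<^sup>T)\<^sup>T"
    using KL R B by (subst transpose_add[of _ n n]) (auto simp: transpose_mult[of _ n n _ n] transpose_mult[of _ n m _ n])
  also have "\<dots> = 1\<^sub>m n" by (simp add: KL)
  finally show thesis using that[of "K\<^sup>T" "L\<^sup>T"] KL by simp
qed

text \<open>Controllability of the transposed system, transposed back.\<close>

lemma minimal_realization_observable:
  assumes min: "minimal_realization G A B C D" and n: "n = dim_row A" and p: "p = dim_row G"
  obtains K L where "K \<in> carrier_mat n n" "L \<in> carrier_mat n p"
    "K * (l \<cdot>\<^sub>m 1\<^sub>m n - A) + L * C = 1\<^sub>m n"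
proof -
  let ?R = "l \<cdot>\<^sub>m 1\<^sub>m n - A"
  have A: "A \<in> carrier_mat n n" and C: "C \<in> carrier_mat p n"
    using min by (auto simp: minimal_realization_def realization_def n p)
  have R: "?R \<in> carrier_mat n n" using A by (rule minus_carrier_mat)
  obtain U V where UV: "U \<in> carrier_mat n n" "V \<in> carrier_mat p n"
    "(l \<cdot>\<^sub>m 1\<^sub>m n - A\<^sup>T) * U + C\<^sup>T * V = 1\<^sub>m n"
    using minimal_realization_controllable[OF minimal_realization_transpose[OF min], of n p l] A p
    by auto
  have "U\<^sup>T * ?R + V\<^sup>T * C = (?R\<^sup>T * U + C\<^sup>T * V)\<^sup>T"
    using UV R C by (subst transpose_add[of _ n n]) (auto simp: transpose_mult[of _ n n _ n] transpose_mult[of _ n p _ n])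
  also have "\<dots> = 1\<^sub>m n" using UV(3) by (simp add: resolvent_arg_transpose[OF A])
  finally show thesis using that[of "U\<^sup>T" "V\<^sup>T"] UV by simp
qed

subsection \<open>Existence of realizations\<close>

text \<open>Reindexing by \<open>r = k * n + i\<close> turns a sum over all states into a sum over
  blocks and positions within a block.\<close>

lemma sum_div_mod_nat:
  fixes f :: "nat \<Rightarrow> nat \<Rightarrow> 'a :: comm_monoid_add"
  shows "(\<Sum>r<m * n. f (r div n) (r mod n)) = (\<Sum>k<m. \<Sum>i<n. f k i)"
proof -
  have "(\<Sum>i<n. f k i) = (\<Sum>r = k * n..<k * n + n. f (r div n) (r mod n))" for k
  proof -
    have "(\<Sum>r = k * n..<k * n + n. f (r div n) (r mod n)) =
        (\<Sum>i = 0..<n. f ((i + k * n) div n) ((i + k * n) mod n))"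
      using sum.shift_bounds_nat_ivl[of "\<lambda>r. f (r div n) (r mod n)" 0 "k * n" n]
      by (simp add: add.commute)
    then show ?thesis by (simp add: atLeast0LessThan)
  qed
  then show ?thesis by (simp add: sum.nat_group mult.commute)
qed

text \<open>The product of all \<open>b x\<close> serves as \<open>d\<close>, each numerator being
  multiplied by the denominators of the other entries. The zeros of the product are exactly those of
  its factors, so no new exceptional points arise.\<close>

lemma common_denominator:
  fixes a b :: "'i \<Rightarrow> 'a :: field poly"
  assumes I: "finite I" and b: "\<And>x. x \<in> I \<Longrightarrow> b x \<noteq> 0"
    and deg: "\<And>x. x \<in> I \<Longrightarrow> degree (a x) \<le> degree (b x)"
  obtains q d where "d \<noteq> 0" "\<And>x. x \<in> I \<Longrightarrow> degree (q x) \<le> degree d"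
    "\<And>s. poly d s = 0 \<longleftrightarrow> (\<exists>x\<in>I. poly (b x) s = 0)"
    "\<And>x s. x \<in> I \<Longrightarrow> poly d s \<noteq> 0 \<Longrightarrow> poly (q x) s / poly d s = poly (a x) s / poly (b x) s"
proof (rule that)
  let ?d = "\<Prod>x\<in>I. b x" and ?q = "\<lambda>x. a x * (\<Prod>y\<in>I - {x}. b y)"
  show "?d \<noteq> 0" using I b by simp
  show z: "poly ?d s = 0 \<longleftrightarrow> (\<exists>x\<in>I. poly (b x) s = 0)" for s
    using I by (simp add: poly_prod)
  fix x assume x: "x \<in> I"
  have d: "?d = b x * (\<Prod>y\<in>I - {x}. b y)" using prod.remove[OF I x] .
  have ne: "(\<Prod>y\<in>I - {x}. b y) \<noteq> 0" using I b by simp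
  show "degree (?q x) \<le> degree ?d"
    unfolding d using degree_mult_le[of "a x" "\<Prod>y\<in>I - {x}. b y"] deg[OF x]
    by (simp add: degree_mult_eq[OF b[OF x] ne])
  show "poly (?q x) s / poly ?d s = poly (a x) s / poly (b x) s" if "poly ?d s \<noteq> 0" for s
    using that unfolding d by simp
qed

text \<open>
  One companion block per input: at a state index \<open>r\<close> the input is \<open>r div n\<close>, and the column
  \<open>(1, s, \<dots>, s\<^sup>n\<^sup>-\<^sup>1) / d(s)\<close> solves the resolvent equation of the block.
\<close>

lemma companion_realization:
  fixes d :: "complex poly" and q :: "nat \<Rightarrow> nat \<Rightarrow> complex poly"
  assumes d: "d \<noteq> 0"
    and deg: "\<And>j k. j < p \<Longrightarrow> k < m \<Longrightarrow> degree (q j k) \<le> degree d"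
  obtains A B C D N where "A \<in> carrier_mat N N" "B \<in> carrier_mat N m" "C \<in> carrier_mat p N"
    "D \<in> carrier_mat p m"
    "\<And>s. poly d s \<noteq> 0 \<Longrightarrow> \<exists>X\<in>carrier_mat N m. (s \<cdot>\<^sub>m 1\<^sub>m N - A) * X = B \<and>
       D + C * X = mat p m (\<lambda>(j, k). poly (q j k) s / poly d s)"
proof -
  define n where "n = degree d"
  define c where "c = lead_coeff d"
  have c0: "c \<noteq> 0" using d by (simp add: c_def)
  define A where "A = mat (m * n) (m * n) (\<lambda>(r, r'). if r div n \<noteq> r' div n then 0
    else if Suc (r mod n) < n then (if r' mod n = Suc (r mod n) then 1 else 0)
    else - coeff d (r' mod n) / c)"
  define B where "B = mat (m * n) m (\<lambda>(r, k). if r div n = k \<and> Suc (r mod n) = n then 1 / c else 0)"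
  \<comment> \<open>\<open>D\<close> is the value at infinity. \<open>C\<close> holds the
    coefficients of the remainder \<open>q - (q_n / c) d\<close>, where \<open>q_n\<close> is the
    coefficient of degree \<open>n\<close>; the remainder has no term of degree
    \<open>n\<close>.\<close>
  define D where "D = mat p m (\<lambda>(j, k). coeff (q j k) n / c)"
  define C where "C = mat p (m * n) (\<lambda>(j, r). coeff (q j (r div n)) (r mod n)
    - coeff (q j (r div n)) n / c * coeff d (r mod n))"
  have Ac: "A \<in> carrier_mat (m * n) (m * n)" by (simp add: A_def)
  have "\<exists>X\<in>carrier_mat (m * n) m. (s \<cdot>\<^sub>m 1\<^sub>m (m * n) - A) * X = B \<and>
       D + C * X = mat p m (\<lambda>(j, k). poly (q j k) s / poly d s)"
    if s: "poly d s \<noteq> 0" for s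
  proof -
    define X where "X = mat (m * n) m (\<lambda>(r, k). if r div n = k then s ^ (r mod n) / poly d s else 0)"
    have X: "X \<in> carrier_mat (m * n) m" by (simp add: X_def)
    have pd: "poly d s = (\<Sum>i<n. coeff d i * s ^ i) + c * s ^ n"
      unfolding poly_altdef n_def c_def by (simp flip: lessThan_Suc_atMost)
    have "(s \<cdot>\<^sub>m 1\<^sub>m (m * n) - A) * X = B"
    proof (rule eq_matI)
      fix r k assume "r < dim_row B" "k < dim_col B"
      then have r: "r < m * n" and k: "k < m" by (auto simp: B_def)
      \<comment> \<open>A constant \<open>d\<close> gives \<open>n = 0\<close> and an empty state
        space; the existence of a row \<open>r\<close> excludes this.\<close>
      then have n0: "n > 0" by (cases n) auto
      have rd: "r div n < m" using r n0 by (simp add: less_mult_imp_div_less)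
      have rm: "r mod n < n" using n0 by simp
      have "((s \<cdot>\<^sub>m 1\<^sub>m (m * n) - A) * X) $$ (r, k) =
          (\<Sum>r'<m * n. ((if r = r' then s else 0) - A $$ (r, r')) * X $$ (r', k))"
        using r k Ac X by (auto simp: scalar_prod_def atLeast0LessThan intro!: sum.cong)
      also have "\<dots> = s * X $$ (r, k) - (\<Sum>r'<m * n. A $$ (r, r') * X $$ (r', k))"
        using r by (simp add: left_diff_distrib sum_subtractf if_distrib[of "\<lambda>a. a * _"] cong: if_cong)
      also have "(\<Sum>r'<m * n. A $$ (r, r') * X $$ (r', k)) =
         (\<Sum>r'<m * n. (\<lambda>k' i'. (if r div n \<noteq> k' then 0
            else if Suc (r mod n) < n then (if i' = Suc (r mod n) then 1 else 0)
            else - coeff d i' / c) * (if k' = k then s ^ i' / poly d s else 0)) (r' div n) (r' mod n))"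
        using r k by (intro sum.cong) (simp_all add: A_def X_def)
      also have "\<dots> = (\<Sum>k'<m. \<Sum>i'<n. (if r div n \<noteq> k' then 0
            else if Suc (r mod n) < n then (if i' = Suc (r mod n) then 1 else 0)
            else - coeff d i' / c) * (if k' = k then s ^ i' / poly d s else 0))"
        by (rule sum_div_mod_nat)
      also have "\<dots> = (\<Sum>k'<m. if k' = r div n then \<Sum>i'<n. (
            if Suc (r mod n) < n then (if i' = Suc (r mod n) then 1 else 0)
            else - coeff d i' / c) * (if k' = k then s ^ i' / poly d s else 0) else 0)"
        by (intro sum.cong) auto
      also have "\<dots> = (\<Sum>i'<n. (
            if Suc (r mod n) < n then (if i' = Suc (r mod n) then 1 else 0)
            else - coeff d i' / c) * (if r div n = k then s ^ i' / poly d s else 0))"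
        using rd by simp
      finally have eq: "((s \<cdot>\<^sub>m 1\<^sub>m (m * n) - A) * X) $$ (r, k) = s * X $$ (r, k) - \<dots>" .
      show "((s \<cdot>\<^sub>m 1\<^sub>m (m * n) - A) * X) $$ (r, k) = B $$ (r, k)"
      proof (cases "r div n = k")
        case False
        then show ?thesis unfolding eq using r k by (simp add: X_def B_def)
      next
        case True
        show ?thesis
        proof (cases "Suc (r mod n) < n")
          case less: True
          have "(\<Sum>i'<n. (if i' = Suc (r mod n) then 1 else 0) * (s ^ i' / poly d s)) =
              s ^ Suc (r mod n) / poly d s"
          proof -
            have "(\<Sum>i'<n. (if i' = Suc (r mod n) then 1 else 0) * (s ^ i' / poly d s)) =
                (\<Sum>i'<n. if i' = Suc (r mod n) then s ^ Suc (r mod n) / poly d s else 0)"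
              by (intro sum.cong) auto
            then show ?thesis using less by simp
          qed
          then show ?thesis unfolding eq using r k True less by (simp add: X_def B_def)
        next
          case False
          then have last: "Suc (r mod n) = n" using rm by simp
          have "s * s ^ (r mod n) = s ^ n" by (metis last power_Suc)
          moreover have "(\<Sum>i'<n. - coeff d i' / c * (s ^ i' / poly d s)) =
              - (\<Sum>i'<n. coeff d i' * s ^ i') / (c * poly d s)"
            by (simp add: sum_divide_distrib sum_negf)
          \<comment> \<open>The last row of a block is the expansion \<open>pd\<close> of
            \<open>d(s)\<close> divided by \<open>c d(s)\<close>.\<close>
          moreover have "s ^ n / poly d s + (\<Sum>i'<n. coeff d i' * s ^ i') / (c * poly d s) = 1 / c"
          proof -
            have "s ^ n / poly d s + (\<Sum>i'<n. coeff d i' * s ^ i') / (c * poly d s)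
              = ((\<Sum>i'<n. coeff d i' * s ^ i') + c * s ^ n) / (c * poly d s)"
              using c0 s by (simp add: field_simps)
            then show ?thesis using s by (simp flip: pd)
          qed
          ultimately show ?thesis unfolding eq using r k True last by (simp add: X_def B_def)
        qed
      qed
    qed (simp_all add: A_def B_def X_def)
    moreover have "D + C * X = mat p m (\<lambda>(j, k). poly (q j k) s / poly d s)"
    proof (rule eq_matI)
      fix j k assume "j < dim_row (mat p m (\<lambda>(j, k). poly (q j k) s / poly d s))"
        "k < dim_col (mat p m (\<lambda>(j, k). poly (q j k) s / poly d s))"
      then have j: "j < p" and k: "k < m" by auto
      let ?q = "q j k"
      have pq: "poly ?q s = (\<Sum>i<n. coeff ?q i * s ^ i) + coeff ?q n * s ^ n"
      proof -
        have "poly ?q s = (\<Sum>i\<le>n. coeff ?q i * s ^ i)"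
          unfolding poly_altdef using deg[OF j k]
          by (intro sum.mono_neutral_left) (auto simp: n_def coeff_eq_0)
        then show ?thesis by (simp flip: lessThan_Suc_atMost)
      qed
      have "(C * X) $$ (j, k) = (\<Sum>r<m * n. (\<lambda>k' i. (coeff (q j k') i - coeff (q j k') n / c * coeff d i) *
            (if k' = k then s ^ i / poly d s else 0)) (r div n) (r mod n))"
        using j k by (simp add: C_def X_def scalar_prod_def atLeast0LessThan)
      also have "\<dots> = (\<Sum>k'<m. \<Sum>i<n. (coeff (q j k') i - coeff (q j k') n / c * coeff d i) *
            (if k' = k then s ^ i / poly d s else 0))"
        by (rule sum_div_mod_nat)
      also have "\<dots> = (\<Sum>k'<m. if k' = k then
            \<Sum>i<n. (coeff ?q i - coeff ?q n / c * coeff d i) * (s ^ i / poly d s) else 0)"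
        by (intro sum.cong) auto
      also have "\<dots> = (\<Sum>i<n. (coeff ?q i - coeff ?q n / c * coeff d i) * (s ^ i / poly d s))"
        using k by simp
      also have "\<dots> = ((\<Sum>i<n. coeff ?q i * s ^ i) - coeff ?q n / c * (\<Sum>i<n. coeff d i * s ^ i)) / poly d s"
        by (simp add: sum_divide_distrib sum_distrib_left sum_subtractf[symmetric] left_diff_distrib
            diff_divide_distrib mult.assoc)
      \<comment> \<open>In the remainder the terms of degree \<open>n\<close> cancel, and the
        subtracted constant is the entry of \<open>D\<close>.\<close>
      also have "\<dots> = poly ?q s / poly d s - coeff ?q n / c"
      proof -
        have e: "(\<Sum>i<n. coeff ?q i * s ^ i) = poly ?q s - coeff ?q n * s ^ n"
          "(\<Sum>i<n. coeff d i * s ^ i) = poly d s - c * s ^ n"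
          using pq pd by simp_all
        show ?thesis unfolding e using s c0 by (simp add: field_simps)
      qed
      finally show "(D + C * X) $$ (j, k) = mat p m (\<lambda>(j, k). poly (q j k) s / poly d s) $$ (j, k)"
        using j k X by (simp add: D_def C_def)
    qed (use X in \<open>simp_all add: D_def C_def\<close>)
    ultimately show ?thesis using X by blast
  qed
  then show thesis by (intro that[of A "m * n" B C D]) (auto simp: A_def B_def C_def D_def)
qed

text \<open>The entries are brought over a common denominator \<open>d\<close> and realized by
  companion blocks. Since \<open>d\<close> vanishes only at poles of \<open>G\<close>, the identity
  holds at every point where \<open>realization\<close> demands it.\<close>

lemma realization_exists:
  assumes "proper_tf G"
  shows "\<exists>A B C D. realization G A B C D"
proof -
  let ?p = "dim_row G" and ?m = "dim_col G"
  define a where "a = (\<lambda>(j, k). map_poly (of_real :: real \<Rightarrow> complex) (fst (quot_of_fract (G $$ (j, k)))))"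
  define b where "b = (\<lambda>(j, k). map_poly (of_real :: real \<Rightarrow> complex) (snd (quot_of_fract (G $$ (j, k)))))"
  have b0: "b x \<noteq> 0" for x
    using snd_quot_of_fract_nonzero[of "G $$ x"]
    by (cases x) (auto simp: b_def map_poly_eq_0_iff)
  have ab: "degree (a x) \<le> degree (b x)" if "x \<in> {..<?p} \<times> {..<?m}" for x
    using that assms by (auto simp: a_def b_def proper_tf_def fract_proper_def degree_map_poly)
  have fin: "finite ({..<?p} \<times> {..<?m})" by simp
  obtain q d where d: "d \<noteq> 0"
    and deg: "\<And>x. x \<in> {..<?p} \<times> {..<?m} \<Longrightarrow> degree (q x) \<le> degree d"
    and zero: "\<And>s. poly d s = 0 \<longleftrightarrow> (\<exists>x\<in>{..<?p} \<times> {..<?m}. poly (b x) s = 0)"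
    and quot: "\<And>x s. x \<in> {..<?p} \<times> {..<?m} \<Longrightarrow> poly d s \<noteq> 0 \<Longrightarrow>
      poly (q x) s / poly d s = poly (a x) s / poly (b x) s"
    by (rule common_denominator[OF fin, of b a]) (assumption | rule b0 ab that)+
  obtain A B C D N where c: "A \<in> carrier_mat N N" "B \<in> carrier_mat N ?m" "C \<in> carrier_mat ?p N"
    "D \<in> carrier_mat ?p ?m"
    and X: "\<And>s. poly d s \<noteq> 0 \<Longrightarrow> \<exists>X\<in>carrier_mat N ?m. (s \<cdot>\<^sub>m 1\<^sub>m N - A) * X = B \<and>
       D + C * X = mat ?p ?m (\<lambda>(j, k). poly (q (j, k)) s / poly d s)"
    by (rule companion_realization[OF d, of ?p ?m "\<lambda>j k. q (j, k)"])
      (assumption | rule deg that | simp)+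
  have "tf_eval G s = D + C * mat_inv (s \<cdot>\<^sub>m 1\<^sub>m N - A) * B"
    if s: "det (s \<cdot>\<^sub>m 1\<^sub>m N - A) \<noteq> 0" "\<not> tf_pole G s" for s
  proof -
    have R: "s \<cdot>\<^sub>m 1\<^sub>m N - A \<in> carrier_mat N N" using c by (intro minus_carrier_mat)
    have ds: "poly d s \<noteq> 0"
      using s(2) by (auto simp: zero tf_pole_def fract_pole_def b_def)
    then obtain X where X: "X \<in> carrier_mat N ?m" "(s \<cdot>\<^sub>m 1\<^sub>m N - A) * X = B"
       "D + C * X = mat ?p ?m (\<lambda>(j, k). poly (q (j, k)) s / poly d s)"
      using X by blast
    have "tf_eval G s = mat ?p ?m (\<lambda>(j, k). poly (q (j, k)) s / poly d s)"
      by (rule eq_matI) (use ds in \<open>auto simp: tf_eval_def fract_eval_def quot a_def b_def\<close>)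
    also have "\<dots> = D + C * (mat_inv (s \<cdot>\<^sub>m 1\<^sub>m N - A) * B)"
      using X mat_inv_mult_eqI[OF R s(1) X(1,2)] by simp
    also have "C * (mat_inv (s \<cdot>\<^sub>m 1\<^sub>m N - A) * B) = C * mat_inv (s \<cdot>\<^sub>m 1\<^sub>m N - A) * B"
      by (rule assoc_mult_mat[symmetric, of _ ?p N _ N _ ?m]) (use c mat_inv(1)[OF R s(1)] in auto)
    finally show ?thesis .
  qed
  then have "realization G A B C D" using c by (auto simp: realization_def)
  then show ?thesis by blast
qed

text \<open>Properness provides a realization, hence one of least state dimension, so the choice
  operator has a witness to pick.\<close>

lemma some_minimal_realization:
  assumes "proper_tf G" "some_minimal_realization G = (A, B, C, D)"
  shows "minimal_realization G A B C D"
proof -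
  obtain x where x: "case x of (A, B, C, D) \<Rightarrow> realization G A B C D"
    using realization_exists[OF assms(1)] by auto
  obtain y where "case y of (A, B, C, D) \<Rightarrow> realization G A B C D"
    "\<forall>z. (case z of (A, B, C, D) \<Rightarrow> realization G A B C D) \<longrightarrow> dim_row (fst y) \<le> dim_row (fst z)"
    using ex_has_least_nat[of "\<lambda>x. case x of (A, B, C, D) \<Rightarrow> realization G A B C D" x "\<lambda>z. dim_row (fst z)"] x
    by blast
  then have "case y of (A, B, C, D) \<Rightarrow> minimal_realization G A B C D"
    by (cases y) (auto simp: minimal_realization_def)
  then have "case some_minimal_realization G of (A, B, C, D) \<Rightarrow> minimal_realization G A B C D"
    unfolding some_minimal_realization_def by (rule someI)
  then show ?thesis by (simp add: assms(2))
qed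

subsection \<open>Coprime factors and pole directions\<close>

lemma open_open_rhp: "open open_rhp"
  unfolding open_rhp_def by (rule open_halfspace_Re_gt)

lemma connected_open_rhp: "connected open_rhp"
  unfolding open_rhp_def by (intro convex_connected convex_halfspace_Re_gt)

lemma open_rhp_subset_closed_rhp: "open_rhp \<subseteq> closed_rhp"
  by (auto simp: open_rhp_def closed_rhp_def)

lemma H_inf_det_holomorphic:
  assumes "M \<in> H_inf n n"
  shows "(\<lambda>s. det (M s)) holomorphic_on open_rhp"
proof -
  have "(\<lambda>s. \<Sum>q | q permutes {0..<n}. signof q * (\<Prod>i = 0..<n. M s $$ (i, q i))) holomorphic_on open_rhp"
    using assms by (intro holomorphic_intros) (auto simp: H_inf_def permutes_in_image)
  then show ?thesis
    by (rule holomorphic_transform) (use assms in \<open>auto simp: H_inf_def det_def'\<close>)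
qed

lemma H_inf_bounded:
  assumes "M \<in> H_inf p m" "i < p" "j < m" "\<forall>\<^sub>F s in F. s \<in> open_rhp"
  shows "\<exists>K. \<forall>\<^sub>F s in F. norm (M s $$ (i, j)) \<le> K"
proof -
  have "bounded ((\<lambda>s. M s $$ (i, j)) ` open_rhp)" using assms by (simp add: H_inf_def)
  then obtain K where "\<forall>s\<in>open_rhp. norm (M s $$ (i, j)) \<le> K"
    unfolding bounded_iff by auto
  then show ?thesis using assms(4) by (auto elim!: eventually_mono intro!: exI[of _ K])
qed

text \<open>If no good points accumulated at \<open>l\<close>, then \<open>det M\<close> would
  vanish on a nonempty open part of the half-plane, hence on all of it by the identity
  theorem.\<close>

lemma generic_points_limit:
  assumes M: "M \<in> H_inf n n" and nz: "\<exists>s\<in>open_rhp. det (M s) \<noteq> 0"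
    and E: "finite E" and l: "l \<in> closed_rhp"
  shows "at l within {s \<in> open_rhp. det (M s) \<noteq> 0 \<and> s \<notin> E} \<noteq> bot"
proof -
  have "l islimpt {s \<in> open_rhp. det (M s) \<noteq> 0 \<and> s \<notin> E}"
    unfolding islimpt_approachable
  proof (intro allI impI, rule ccontr)
    fix e :: real assume e: "e > 0"
    assume no: "\<not> (\<exists>x'\<in>{s \<in> open_rhp. det (M s) \<noteq> 0 \<and> s \<notin> E}. x' \<noteq> l \<and> dist x' l < e)"
    define V where "V = ball l e \<inter> open_rhp"
    define U where "U = V - (E \<union> {l})"
    have V: "open V" unfolding V_def by (intro open_Int open_ball open_open_rhp)
    \<comment> \<open>For imaginary \<open>l\<close> the ball is not contained in the half-plane;
      moving right from \<open>l\<close> reaches a common point.\<close>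
    have "l + of_real (e / 2) \<in> V"
      using e l by (simp add: V_def open_rhp_def closed_rhp_def dist_norm)
    then have "infinite V" using V finite_imp_not_open by blast
    then have "U \<noteq> {}" using E unfolding U_def by (metis finite.emptyI finite_Diff2 finite_insert finite_Un)
    then obtain z where z: "z \<in> U" by auto
    have U: "open U" unfolding U_def using E V by (intro open_Diff finite_imp_closed) auto
    have lim: "z islimpt U" using interior_limit_point[of z U] z U by (simp add: interior_open)
    have zero: "det (M s) = 0" if "s \<in> U" for s
      using no that by (auto simp: U_def V_def dist_commute)
    obtain s where s: "s \<in> open_rhp" "det (M s) \<noteq> 0" using nz by blast
    have "det (M s) = 0"
      by (rule analytic_continuation[OF H_inf_det_holomorphic[OF M] open_open_rhp connected_open_rhp
            _ _ lim zero s(1)])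
        (use z in \<open>auto simp: U_def V_def\<close>)
    with s show False by simp
  qed
  then show ?thesis by (simp add: trivial_limit_within)
qed

lemma mult_mat_zero_vec:
  fixes A :: "'a :: semiring_0 mat"
  assumes "A \<in> carrier_mat p n"
  shows "A *\<^sub>v 0\<^sub>v n = 0\<^sub>v p"
  using assms by (intro eq_vecI) auto

lemma smult_mat_mult_vec:
  fixes A :: "'a :: comm_ring_1 mat"
  assumes "A \<in> carrier_mat p n" "v \<in> carrier_vec n"
  shows "(k \<cdot>\<^sub>m A) *\<^sub>v v = k \<cdot>\<^sub>v (A *\<^sub>v v)"
  using assms by (intro eq_vecI) (auto simp: scalar_prod_def sum_distrib_left mult.assoc)

lemma add_right_commute_mat:
  fixes X Y Z :: "'a :: ab_semigroup_add mat"
  assumes "X \<in> carrier_mat p n" "Y \<in> carrier_mat p n" "Z \<in> carrier_mat p n"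
  shows "X + Y + Z = X + Z + Y"
  using assms by (intro eq_matI) (auto simp: ac_simps)

lemma resolvent_arg_shift:
  fixes A :: "complex mat"
  assumes "A \<in> carrier_mat n n"
  shows "s \<cdot>\<^sub>m 1\<^sub>m n - A = (l \<cdot>\<^sub>m 1\<^sub>m n - A) + (s - l) \<cdot>\<^sub>m 1\<^sub>m n"
  using assms by (intro eq_matI) (auto simp: algebra_simps)

section \<open>Kernels of left denominators\<close>

text \<open>At \<open>l\<close> the resolvent may be singular, and if \<open>l\<close> is imaginary
  only \<open>M\<close> is known to be continuous there. Each inclusion therefore comes from an
  exact identity at nearby regular points, arranged so that all its terms have limits.\<close>

lemma left_coprime_kernel:
  assumes min: "minimal_realization G A B C D"
    and fac: "left_coprime_factorization G M N" and l: "l \<in> closed_rhp"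
  shows "mat_kernel (M l) = (\<lambda>v. C *\<^sub>v v) ` mat_kernel (l \<cdot>\<^sub>m 1\<^sub>m (dim_row A) - A)"
proof -
  obtain n p m where dims: "n = dim_row A" "p = dim_row G" "m = dim_col G" by simp
  have A: "A \<in> carrier_mat n n" and B: "B \<in> carrier_mat n m" and C: "C \<in> carrier_mat p n"
    and D: "D \<in> carrier_mat p m"
    and real: "\<And>s. det (s \<cdot>\<^sub>m 1\<^sub>m n - A) \<noteq> 0 \<Longrightarrow> \<not> tf_pole G s \<Longrightarrow>
       tf_eval G s = D + C * mat_inv (s \<cdot>\<^sub>m 1\<^sub>m n - A) * B"
    using min unfolding minimal_realization_def realization_def dims by auto
  have M: "M \<in> H_inf p p" and N: "N \<in> H_inf p m"
    and cont: "continuous_on_closed_rhp p M"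
    and nz: "\<exists>s\<in>open_rhp. det (M s) \<noteq> 0"
    and quot: "\<And>s. s \<in> open_rhp \<Longrightarrow> det (M s) \<noteq> 0 \<Longrightarrow> \<not> tf_pole G s \<Longrightarrow>
       tf_eval G s = mat_inv (M s) * N s"
    using fac unfolding left_coprime_factorization_def left_coprime_def dims by auto
  obtain X Y where X: "X \<in> H_inf p p" and Y: "Y \<in> H_inf m p"
    and bez: "\<And>s. s \<in> open_rhp \<Longrightarrow> M s * X s + N s * Y s = 1\<^sub>m p"
    using fac unfolding left_coprime_factorization_def left_coprime_def dims by auto
  have Ml: "M l \<in> carrier_mat p p" using cont l by (simp add: continuous_on_closed_rhp_def)
  let ?R = "\<lambda>s. s \<cdot>\<^sub>m 1\<^sub>m n - A"
  have Rc: "?R s \<in> carrier_mat n n" for s using A by (rule minus_carrier_mat)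
  \<comment> \<open>On \<open>S\<close> the denominator is invertible, \<open>G\<close> has no pole
    and the resolvent exists, so both formulas for \<open>G\<close> are valid.\<close>
  define S where "S = {s \<in> open_rhp. det (M s) \<noteq> 0 \<and> s \<notin> {s. tf_pole G s} \<union> {s. det (?R s) = 0}}"
  define F where "F = at l within S"
  have Fbot: "F \<noteq> bot"
    unfolding F_def S_def
    by (intro generic_points_limit[OF M nz _ l] finite_UnI finite_tf_poles finite_resolvent_poles A)
  have evS: "\<forall>\<^sub>F s in F. s \<in> S" by (simp add: F_def eventually_at_filter)
  then have evO: "\<forall>\<^sub>F s in F. s \<in> open_rhp" by eventually_elim (simp add: S_def)
  have limM: "mat_tendsto M (M l) p p F"
  proof -
    have "((\<lambda>s. M s $$ (i, j)) \<longlongrightarrow> M l $$ (i, j)) F" if "i < p" "j < p" for i j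
    proof -
      have "((\<lambda>s. M s $$ (i, j)) \<longlongrightarrow> M l $$ (i, j)) (at l within closed_rhp)"
        using cont l that by (auto simp: continuous_on_closed_rhp_def continuous_on_def)
      then show ?thesis
        unfolding F_def by (rule tendsto_within_subset)
          (use open_rhp_subset_closed_rhp in \<open>auto simp: S_def\<close>)
    qed
    moreover have "\<forall>\<^sub>F s in F. M s \<in> carrier_mat p p"
      using evO by eventually_elim (use M in \<open>simp add: H_inf_def\<close>)
    ultimately show ?thesis using Ml by (simp add: mat_tendsto_def)
  qed
  have bdd: "vec_tendsto (\<lambda>s. Z s *\<^sub>v g s) (0\<^sub>v a) a F"
    if Z: "Z \<in> H_inf a b" and g: "vec_tendsto g (0\<^sub>v b) b F" for Z a b g
  proof (rule mat_tendsto_bounded_zero[OF _ _ g])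
    show "\<forall>\<^sub>F s in F. Z s \<in> carrier_mat a b"
      using evO by eventually_elim (use Z in \<open>simp add: H_inf_def\<close>)
  qed (rule H_inf_bounded[OF Z _ _ evO])
  have limR: "mat_tendsto ?R (?R l) n n F"
    unfolding F_def by (rule mat_tendsto_resolvent_arg[OF A])
  \<comment> \<open>Moving a one-sided inverse identity from \<open>l\<close> to \<open>s\<close>
    replaces the unit matrix by this one. It tends to the unit matrix and is thus invertible near
    \<open>l\<close>. It is used with \<open>K\<close> from observability and with \<open>U\<close>
    from controllability.\<close>
  have limE: "mat_tendsto (\<lambda>s. 1\<^sub>m n + (s - l) \<cdot>\<^sub>m K) (1\<^sub>m n) n n F" if K: "K \<in> carrier_mat n n" for K
  proof -
    have "mat_tendsto (\<lambda>s. 1\<^sub>m n + (s - l) \<cdot>\<^sub>m K) (1\<^sub>m n + (l - l) \<cdot>\<^sub>m K) n n F"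
      unfolding F_def
      by (intro mat_tendsto_add mat_tendsto_smult mat_tendsto_const tendsto_intros K one_carrier_mat)
    moreover have "1\<^sub>m n + (l - l) \<cdot>\<^sub>m K = 1\<^sub>m n" using K by (intro eq_matI) auto
    ultimately show ?thesis by simp
  qed
  have Ec: "1\<^sub>m n + (s - l) \<cdot>\<^sub>m K \<in> carrier_mat n n" if "K \<in> carrier_mat n n" for K s
    using that by simp
  have detone: "det (1\<^sub>m n :: complex mat) \<noteq> 0" by simp
  have at: "M s \<in> carrier_mat p p" "N s \<in> carrier_mat p m" "X s \<in> carrier_mat p p"
      "Y s \<in> carrier_mat m p" "tf_eval G s \<in> carrier_mat p m" "M s * tf_eval G s = N s"
      "mat_inv (?R s) \<in> carrier_mat n n" "?R s * mat_inv (?R s) = 1\<^sub>m n" "mat_inv (?R s) * ?R s = 1\<^sub>m n"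
      "\<And>g. g \<in> carrier_vec m \<Longrightarrow> tf_eval G s *\<^sub>v g = D *\<^sub>v g + C *\<^sub>v (mat_inv (?R s) *\<^sub>v (B *\<^sub>v g))"
    if s: "s \<in> S" for s
  proof -
    show c: "M s \<in> carrier_mat p p" "N s \<in> carrier_mat p m" "X s \<in> carrier_mat p p"
      "Y s \<in> carrier_mat m p"
      using s M N X Y by (auto simp: S_def H_inf_def)
    show "tf_eval G s \<in> carrier_mat p m" by (simp add: tf_eval_def dims)
    have "det (M s) \<noteq> 0" and dR: "det (?R s) \<noteq> 0" and np: "\<not> tf_pole G s" and so: "s \<in> open_rhp"
      using s by (auto simp: S_def)
    note Mi = mat_inv[OF c(1) this(1)]
    show "M s * tf_eval G s = N s"
      unfolding quot[OF so \<open>det (M s) \<noteq> 0\<close> np]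
      using c Mi by (simp flip: assoc_mult_mat[of _ p p _ p _ m])
    show Ri: "mat_inv (?R s) \<in> carrier_mat n n" "?R s * mat_inv (?R s) = 1\<^sub>m n"
      "mat_inv (?R s) * ?R s = 1\<^sub>m n"
      using mat_inv[OF Rc dR] by auto
    fix g :: "complex vec" assume g: "g \<in> carrier_vec m"
    have "tf_eval G s *\<^sub>v g = D *\<^sub>v g + (C * mat_inv (?R s) * B) *\<^sub>v g"
      unfolding real[OF dR np] using D C Ri B g by (subst add_mult_distrib_mat_vec[of _ p m]) auto
    also have "(C * mat_inv (?R s) * B) *\<^sub>v g = (C * mat_inv (?R s)) *\<^sub>v (B *\<^sub>v g)"
      by (rule assoc_mult_mat_vec[of _ p n _ m]) (use C Ri B g in auto)
    also have "\<dots> = C *\<^sub>v (mat_inv (?R s) *\<^sub>v (B *\<^sub>v g))"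
      by (rule assoc_mult_mat_vec[of _ p n _ n]) (use C Ri B g in auto)
    finally show "tf_eval G s *\<^sub>v g = D *\<^sub>v g + C *\<^sub>v (mat_inv (?R s) *\<^sub>v (B *\<^sub>v g))" .
  qed
  have "\<exists>v\<in>mat_kernel (?R l). y = C *\<^sub>v v" if y: "y \<in> mat_kernel (M l)" for y
  proof -
    have yc: "y \<in> carrier_vec p" "M l *\<^sub>v y = 0\<^sub>v p" using mat_kernelD[OF Ml y] by auto
    obtain K L where KL: "K \<in> carrier_mat n n" "L \<in> carrier_mat n p" "K * ?R l + L * C = 1\<^sub>m n"
      using minimal_realization_observable[OF min dims(1,2)] .
    let ?E = "\<lambda>s. 1\<^sub>m n + (s - l) \<cdot>\<^sub>m K"
    \<comment> \<open>\<open>x s\<close> is the state response to the input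
      \<open>Y s *\<^sub>v u s\<close>. Although \<open>w\<close> tends to zero, the resolvent may
      blow up, so convergence of \<open>x\<close> still has to be shown.\<close>
    define u where "u = (\<lambda>s. M s *\<^sub>v y)"
    define w where "w = (\<lambda>s. B *\<^sub>v (Y s *\<^sub>v u s))"
    define x where "x = (\<lambda>s. mat_inv (?R s) *\<^sub>v w s)"
    have u: "vec_tendsto u (0\<^sub>v p) p F"
      unfolding u_def yc(2)[symmetric] by (intro mat_tendsto_mult_vec[OF limM] vec_tendsto_const yc)
    have Yu: "vec_tendsto (\<lambda>s. Y s *\<^sub>v u s) (0\<^sub>v m) m F" by (rule bdd[OF Y u])
    have w: "vec_tendsto w (0\<^sub>v n) n F"
      using mat_tendsto_mult_vec[OF mat_tendsto_const[OF B] Yu] B unfolding w_def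
      by (simp add: mult_mat_zero_vec)
    have Cx: "\<forall>\<^sub>F s in F. C *\<^sub>v x s = y - (X s *\<^sub>v u s + D *\<^sub>v (Y s *\<^sub>v u s))"
      using evS
    proof eventually_elim
      case (elim s)
      note c = at[OF elim]
      have so: "s \<in> open_rhp" using elim by (simp add: S_def)
      have us: "u s \<in> carrier_vec p" "Y s *\<^sub>v u s \<in> carrier_vec m" using c yc by (auto simp: u_def)
      let ?P = "tf_eval G s"
      have "M s * (X s + ?P * Y s) = M s * X s + M s * (?P * Y s)"
        by (rule mult_add_distrib_mat[of _ p p _ p]) (use c in auto)
      also have "M s * (?P * Y s) = M s * ?P * Y s"
        by (rule assoc_mult_mat[symmetric, of _ p p _ m _ p]) (use c in auto)
      finally have "M s * (X s + ?P * Y s) = 1\<^sub>m p" using bez[OF so] c(6) by simp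
      \<comment> \<open>For square matrices a right inverse is also a left inverse; this recovers
        \<open>y\<close> from \<open>u s = M s *\<^sub>v y\<close>.\<close>
      then have "(X s + ?P * Y s) * M s = 1\<^sub>m p"
        by (rule mat_mult_left_right_inverse[rotated 2]) (use c in auto)
      then have "y = ((X s + ?P * Y s) * M s) *\<^sub>v y" using yc by simp
      also have "\<dots> = (X s + ?P * Y s) *\<^sub>v u s"
        unfolding u_def by (rule assoc_mult_mat_vec[of _ p p _ p]) (use c yc in auto)
      also have "\<dots> = X s *\<^sub>v u s + (?P * Y s) *\<^sub>v u s"
        by (rule add_mult_distrib_mat_vec[of _ p p]) (use c us in auto)
      also have "(?P * Y s) *\<^sub>v u s = ?P *\<^sub>v (Y s *\<^sub>v u s)"
        by (rule assoc_mult_mat_vec[of _ p m _ p]) (use c us in auto)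
      also have "\<dots> = D *\<^sub>v (Y s *\<^sub>v u s) + C *\<^sub>v x s"
        using c(10)[OF us(2)] by (simp add: x_def w_def)
      finally have y: "y = X s *\<^sub>v u s + (D *\<^sub>v (Y s *\<^sub>v u s) + C *\<^sub>v x s)" .
      have "X s *\<^sub>v u s \<in> carrier_vec p" "D *\<^sub>v (Y s *\<^sub>v u s) \<in> carrier_vec p" "C *\<^sub>v x s \<in> carrier_vec p"
        using c D C B us by (auto simp: x_def w_def)
      moreover have "c = (a + (b + c)) - (a + b)"
        if "a \<in> carrier_vec p" "b \<in> carrier_vec p" "c \<in> carrier_vec p" for a b c :: "complex vec"
        using that by (intro eq_vecI) auto
      ultimately show ?case unfolding y[symmetric] using y by metis
    qed
    have limCx: "vec_tendsto (\<lambda>s. C *\<^sub>v x s) y p F"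
    proof -
      have "vec_tendsto (\<lambda>s. y - (X s *\<^sub>v u s + D *\<^sub>v (Y s *\<^sub>v u s))) (y - (0\<^sub>v p + D *\<^sub>v 0\<^sub>v m)) p F"
        by (intro vec_tendsto_minus vec_tendsto_add mat_tendsto_mult_vec[of _ _ _ m] vec_tendsto_const
            mat_tendsto_const bdd[OF X u] Yu yc(1) D)
      moreover have "y - (0\<^sub>v p + D *\<^sub>v 0\<^sub>v m) = y" using D yc by (auto intro!: eq_vecI)
      ultimately show ?thesis using vec_tendsto_cong[OF _ Cx] by simp
    qed
    \<comment> \<open>This is the limit of \<open>x\<close>, written in the unsimplified form in
      which the continuity lemmas deliver it.\<close>
    define v where "v = mat_inv (1\<^sub>m n) *\<^sub>v (K *\<^sub>v 0\<^sub>v n + L *\<^sub>v y)"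
    have "vec_tendsto (\<lambda>s. mat_inv (?E s) *\<^sub>v (K *\<^sub>v w s + L *\<^sub>v (C *\<^sub>v x s))) v n F"
      unfolding v_def
      by (intro mat_tendsto_mult_vec[of _ _ n n] mat_tendsto_mult_vec[of _ _ n p] mat_tendsto_inv(2)[OF limE]
          vec_tendsto_add mat_tendsto_const KL(1,2) detone w limCx)
    \<comment> \<open>Since \<open>?E s = K (sI - A) + L C\<close>, applying it to
      \<open>x s\<close> leaves only \<open>(sI - A) x = w\<close> and \<open>C x\<close>, both of
      which converge. The resolvent has disappeared.\<close>
    moreover have "\<forall>\<^sub>F s in F. x s = mat_inv (?E s) *\<^sub>v (K *\<^sub>v w s + L *\<^sub>v (C *\<^sub>v x s))"
      using evS mat_tendsto_inv(1)[OF limE[OF KL(1)] detone]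
    proof eventually_elim
      case (elim s)
      note c = at[OF elim(1)]
      have ws: "w s \<in> carrier_vec n" "x s \<in> carrier_vec n" using c B yc by (auto simp: x_def w_def u_def)
      have "?R s *\<^sub>v x s = w s"
        unfolding x_def using c ws Rc by (simp flip: assoc_mult_mat_vec[of _ n n _ n])
      moreover have "?E s = K * ?R s + L * C"
      proof -
        have "K * ?R s = K * ?R l + K * ((s - l) \<cdot>\<^sub>m 1\<^sub>m n)"
          unfolding resolvent_arg_shift[OF A, of s l]
          by (rule mult_add_distrib_mat[of _ n n _ n]) (use KL Rc in auto)
        also have "K * ((s - l) \<cdot>\<^sub>m 1\<^sub>m n) = (s - l) \<cdot>\<^sub>m K"
          using KL(1) by (simp add: mult_smult_distrib[of _ n n _ n])
        finally have "K * ?R s + L * C = (K * ?R l + L * C) + (s - l) \<cdot>\<^sub>m K"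
          using KL(1,2) C Rc[of l] by (simp add: add_right_commute_mat[of _ n n "(s - l) \<cdot>\<^sub>m K"])
        then show ?thesis using KL(3) by simp
      qed
      moreover have "(K * ?R s + L * C) *\<^sub>v x s = K *\<^sub>v (?R s *\<^sub>v x s) + L *\<^sub>v (C *\<^sub>v x s)"
      proof -
        have "(K * ?R s + L * C) *\<^sub>v x s = (K * ?R s) *\<^sub>v x s + (L * C) *\<^sub>v x s"
          by (rule add_mult_distrib_mat_vec[of _ n n]) (intro mult_carrier_mat[OF KL(1) Rc] mult_carrier_mat[OF KL(2) C] ws)+
        also have "(K * ?R s) *\<^sub>v x s = K *\<^sub>v (?R s *\<^sub>v x s)"
          by (rule assoc_mult_mat_vec[of _ n n _ n]) (use KL Rc ws in auto)
        also have "(L * C) *\<^sub>v x s = L *\<^sub>v (C *\<^sub>v x s)"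
          by (rule assoc_mult_mat_vec[of _ n p _ n]) (use KL C ws in auto)
        finally show ?thesis .
      qed
      ultimately have "K *\<^sub>v w s + L *\<^sub>v (C *\<^sub>v x s) = ?E s *\<^sub>v x s" by simp
      moreover have "mat_inv (?E s) *\<^sub>v (?E s *\<^sub>v x s) = x s"
        using mat_inv[OF Ec[OF KL(1)] elim(2)] ws Ec[OF KL(1)]
        by (simp flip: assoc_mult_mat_vec[of _ n n _ n])
      ultimately show ?case by simp
    qed
    ultimately have limx: "vec_tendsto x v n F" by (rule vec_tendsto_cong)
    have vc: "v \<in> carrier_vec n" using limx by (simp add: vec_tendsto_def)
    have "y = C *\<^sub>v v"
      by (rule vec_tendsto_unique[OF Fbot limCx])
        (intro mat_tendsto_mult_vec[OF _ limx] mat_tendsto_const C)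
    moreover have "?R l *\<^sub>v v = 0\<^sub>v n"
    \<comment> \<open>The product \<open>(sI - A) x\<close> tends to \<open>(lI - A) v\<close> by
      continuity and to zero because it equals \<open>w\<close>.\<close>
    proof (rule vec_tendsto_unique[OF Fbot mat_tendsto_mult_vec[OF limR limx]])
      have "\<forall>\<^sub>F s in F. ?R s *\<^sub>v x s = w s"
        using evS
      proof eventually_elim
        case (elim s)
        note c = at[OF elim]
        have "w s \<in> carrier_vec n" using c B yc by (auto simp: w_def u_def)
        then show ?case
          unfolding x_def using c Rc by (simp flip: assoc_mult_mat_vec[of _ n n _ n])
      qed
      then show "vec_tendsto (\<lambda>s. ?R s *\<^sub>v x s) (0\<^sub>v n) n F" by (rule vec_tendsto_cong[OF w])
    qed
    ultimately show ?thesis using mat_kernelI[OF Rc vc] by blast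
  qed
  moreover have "C *\<^sub>v v \<in> mat_kernel (M l)" if v: "v \<in> mat_kernel (?R l)" for v
  proof -
    have vc: "v \<in> carrier_vec n" "?R l *\<^sub>v v = 0\<^sub>v n" using mat_kernelD[OF Rc v] by auto
    obtain U V where UV: "U \<in> carrier_mat n n" "V \<in> carrier_mat m n" "?R l * U + B * V = 1\<^sub>m n"
      using minimal_realization_controllable[OF min dims(1,3)] .
    let ?E = "\<lambda>s. 1\<^sub>m n + (s - l) \<cdot>\<^sub>m U"
    \<comment> \<open>\<open>g s\<close> solves \<open>?E s *\<^sub>v g s = (s - l) v\<close>; the
      factor \<open>s - l\<close> makes it tend to zero.\<close>
    define g where "g = (\<lambda>s. ((s - l) \<cdot>\<^sub>m mat_inv (?E s)) *\<^sub>v v)"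
    have "mat_tendsto (\<lambda>s. (s - l) \<cdot>\<^sub>m mat_inv (?E s)) ((l - l) \<cdot>\<^sub>m mat_inv (1\<^sub>m n)) n n F"
      by (intro mat_tendsto_smult mat_tendsto_inv(2)[OF limE[OF UV(1)] detone])
        (auto simp: F_def intro!: tendsto_eq_intros)
    then have "vec_tendsto g (((l - l) \<cdot>\<^sub>m mat_inv (1\<^sub>m n)) *\<^sub>v v) n F"
      unfolding g_def by (rule mat_tendsto_mult_vec[OF _ vec_tendsto_const[OF vc(1)]])
    moreover have "((l - l) \<cdot>\<^sub>m mat_inv (1\<^sub>m n)) *\<^sub>v v = 0\<^sub>v n"
      using mat_inv(1)[OF one_carrier_mat detone] vc by (intro eq_vecI) (auto simp: scalar_prod_def)
    ultimately have g: "vec_tendsto g (0\<^sub>v n) n F" by simp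
    have Vg: "vec_tendsto (\<lambda>s. V *\<^sub>v g s) (0\<^sub>v m) m F"
      using mat_tendsto_mult_vec[OF mat_tendsto_const[OF UV(2)] g] UV(2)
      by (simp add: mult_mat_zero_vec)
    \<comment> \<open>The term with \<open>D\<close> stays on the left so that \<open>D\<close> and
      the resolvent combine into \<open>G\<close>. Then \<open>M G = N\<close> leaves only the
      bounded factor \<open>N\<close> on the right.\<close>
    have lhs: "vec_tendsto (\<lambda>s. M s *\<^sub>v (C *\<^sub>v v) + M s *\<^sub>v (D *\<^sub>v (V *\<^sub>v g s)))
        (M l *\<^sub>v (C *\<^sub>v v) + M l *\<^sub>v (D *\<^sub>v 0\<^sub>v m)) p F"
      by (intro vec_tendsto_add mat_tendsto_mult_vec[OF limM] vec_tendsto_const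
          mat_tendsto_mult_vec[OF mat_tendsto_const[OF D]] Vg) (use C vc in auto)
    have rhs: "vec_tendsto (\<lambda>s. M s *\<^sub>v (C *\<^sub>v (U *\<^sub>v g s)) + N s *\<^sub>v (V *\<^sub>v g s))
        (M l *\<^sub>v (C *\<^sub>v (U *\<^sub>v 0\<^sub>v n)) + 0\<^sub>v p) p F"
      by (intro vec_tendsto_add mat_tendsto_mult_vec[OF limM] bdd[OF N Vg]
          mat_tendsto_mult_vec[OF mat_tendsto_const[OF C]]
          mat_tendsto_mult_vec[OF mat_tendsto_const[OF UV(1)]] g)
    have "\<forall>\<^sub>F s in F. M s *\<^sub>v (C *\<^sub>v v) + M s *\<^sub>v (D *\<^sub>v (V *\<^sub>v g s))
        = M s *\<^sub>v (C *\<^sub>v (U *\<^sub>v g s)) + N s *\<^sub>v (V *\<^sub>v g s)"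
      using evS mat_tendsto_inv(1)[OF limE[OF UV(1)] detone]
    proof eventually_elim
      case (elim s)
      note c = at[OF elim(1)]
      let ?Ri = "mat_inv (?R s)"
      note Ei = mat_inv[OF Ec[OF UV(1)] elim(2)]
      have "g s \<in> carrier_vec n"
        unfolding g_def by (rule mult_mat_vec_carrier[of _ n n]) (use Ei vc in simp_all)
      then have gs: "g s \<in> carrier_vec n" "V *\<^sub>v g s \<in> carrier_vec m" "U *\<^sub>v g s \<in> carrier_vec n"
        using UV by auto
      \<comment> \<open>As \<open>(lI - A) v = 0\<close>, only the shift \<open>s - l\<close>
        remains. It is rewritten as \<open>?E s *\<^sub>v g s\<close> and expanded by
        \<open>?E s = (sI - A) U + B V\<close>, which expresses \<open>v\<close> through
        \<open>g s\<close>.\<close>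
      have "?R s *\<^sub>v v = (s - l) \<cdot>\<^sub>v v"
      proof -
        have "?R s *\<^sub>v v = ?R l *\<^sub>v v + ((s - l) \<cdot>\<^sub>m 1\<^sub>m n) *\<^sub>v v"
          unfolding resolvent_arg_shift[OF A, of s l]
          by (rule add_mult_distrib_mat_vec[of _ n n]) (use Rc vc in auto)
        also have "((s - l) \<cdot>\<^sub>m 1\<^sub>m n) *\<^sub>v v = (s - l) \<cdot>\<^sub>v v"
          using vc by (simp add: smult_mat_mult_vec[of _ n n])
        finally show ?thesis using vc by simp
      qed
      also have "\<dots> = (s - l) \<cdot>\<^sub>v (?E s *\<^sub>v (mat_inv (?E s) *\<^sub>v v))"
        using Ei vc Ec[OF UV(1)] by (simp flip: assoc_mult_mat_vec[of _ n n _ n])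
      also have "\<dots> = ?E s *\<^sub>v g s"
        unfolding g_def using Ei vc Ec[OF UV(1), of s]
        by (simp add: smult_mat_mult_vec[of _ n n] mult_mat_vec[of _ n n])
      also have "?E s = ?R s * U + B * V"
      proof -
        have "?R s * U = ?R l * U + ((s - l) \<cdot>\<^sub>m 1\<^sub>m n) * U"
          unfolding resolvent_arg_shift[OF A, of s l]
          by (rule add_mult_distrib_mat[of _ n n _ _ n]) (use UV Rc in auto)
        also have "((s - l) \<cdot>\<^sub>m 1\<^sub>m n) * U = (s - l) \<cdot>\<^sub>m U"
          using UV(1) by (simp add: mult_smult_assoc_mat[of _ n n _ n])
        finally have "?R s * U + B * V = (?R l * U + B * V) + (s - l) \<cdot>\<^sub>m U"
          using UV(1,2) B Rc[of l] by (simp add: add_right_commute_mat[of _ n n "(s - l) \<cdot>\<^sub>m U"])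
        then show ?thesis using UV(3) by simp
      qed
      also have "(?R s * U + B * V) *\<^sub>v g s = (?R s * U) *\<^sub>v g s + (B * V) *\<^sub>v g s"
        by (rule add_mult_distrib_mat_vec[of _ n n]) (intro mult_carrier_mat[OF Rc UV(1)] mult_carrier_mat[OF B UV(2)] gs)+
      also have "(?R s * U) *\<^sub>v g s = ?R s *\<^sub>v (U *\<^sub>v g s)"
        by (rule assoc_mult_mat_vec[of _ n n _ n]) (use UV Rc gs in auto)
      also have "(B * V) *\<^sub>v g s = B *\<^sub>v (V *\<^sub>v g s)"
        by (rule assoc_mult_mat_vec[of _ n m _ n]) (use UV B gs in auto)
      finally have Rv: "?R s *\<^sub>v v = ?R s *\<^sub>v (U *\<^sub>v g s) + B *\<^sub>v (V *\<^sub>v g s)" .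
      have cancel: "?Ri *\<^sub>v (?R s *\<^sub>v z) = z" if "z \<in> carrier_vec n" for z
        using c Rc that by (simp flip: assoc_mult_mat_vec[of _ n n _ n])
      have "v = ?Ri *\<^sub>v (?R s *\<^sub>v (U *\<^sub>v g s) + B *\<^sub>v (V *\<^sub>v g s))"
        using cancel[OF vc(1)] Rv by simp
      also have "\<dots> = ?Ri *\<^sub>v (?R s *\<^sub>v (U *\<^sub>v g s)) + ?Ri *\<^sub>v (B *\<^sub>v (V *\<^sub>v g s))"
        by (rule mult_add_distrib_mat_vec[of _ n n])
          (intro c(7) mult_mat_vec_carrier[OF Rc gs(3)] mult_mat_vec_carrier[OF B gs(2)])+
      also have "?Ri *\<^sub>v (?R s *\<^sub>v (U *\<^sub>v g s)) = U *\<^sub>v g s" using cancel gs by simp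
      finally have v: "v = U *\<^sub>v g s + ?Ri *\<^sub>v (B *\<^sub>v (V *\<^sub>v g s))" .
      define h where "h = ?Ri *\<^sub>v (B *\<^sub>v (V *\<^sub>v g s))"
      have h: "h \<in> carrier_vec n" using c B gs by (auto simp: h_def)
      have "C *\<^sub>v v = C *\<^sub>v (U *\<^sub>v g s) + C *\<^sub>v h"
        unfolding v h_def[symmetric]
        by (rule mult_add_distrib_mat_vec[of _ p n]) (use C gs h in auto)
      then have "C *\<^sub>v v + D *\<^sub>v (V *\<^sub>v g s) = C *\<^sub>v (U *\<^sub>v g s) + (D *\<^sub>v (V *\<^sub>v g s) + C *\<^sub>v h)"
        using C D gs h by (intro eq_vecI) auto
      also have "D *\<^sub>v (V *\<^sub>v g s) + C *\<^sub>v h = tf_eval G s *\<^sub>v (V *\<^sub>v g s)"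
        using c(10)[OF gs(2)] by (simp add: h_def)
      finally have eq: "C *\<^sub>v v + D *\<^sub>v (V *\<^sub>v g s) = C *\<^sub>v (U *\<^sub>v g s) + tf_eval G s *\<^sub>v (V *\<^sub>v g s)" .
      have "M s *\<^sub>v (C *\<^sub>v v) + M s *\<^sub>v (D *\<^sub>v (V *\<^sub>v g s)) = M s *\<^sub>v (C *\<^sub>v v + D *\<^sub>v (V *\<^sub>v g s))"
        by (rule mult_add_distrib_mat_vec[symmetric, of _ p p]) (use c C D gs vc in auto)
      also have "\<dots> = M s *\<^sub>v (C *\<^sub>v (U *\<^sub>v g s)) + M s *\<^sub>v (tf_eval G s *\<^sub>v (V *\<^sub>v g s))"
        unfolding eq by (rule mult_add_distrib_mat_vec[of _ p p]) (use c(1,5) C gs in auto)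
      also have "M s *\<^sub>v (tf_eval G s *\<^sub>v (V *\<^sub>v g s)) = (M s * tf_eval G s) *\<^sub>v (V *\<^sub>v g s)"
        by (rule assoc_mult_mat_vec[symmetric, of _ p p _ m]) (use c gs in auto)
      finally show ?case by (simp add: c(6))
    qed
    then have "M l *\<^sub>v (C *\<^sub>v v) + M l *\<^sub>v (D *\<^sub>v 0\<^sub>v m) = M l *\<^sub>v (C *\<^sub>v (U *\<^sub>v 0\<^sub>v n)) + 0\<^sub>v p"
      \<comment> \<open>Both sides agree eventually along \<open>F\<close>, so their limits agree;
        every term except \<open>M(l) C v\<close> is zero.\<close>
      by (intro vec_tendsto_unique[OF Fbot lhs] vec_tendsto_cong[OF rhs])
    then have "M l *\<^sub>v (C *\<^sub>v v) = 0\<^sub>v p" using Ml C D UV vc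
      by (simp add: mult_mat_zero_vec)
    then show ?thesis using C vc by (intro mat_kernelI[OF Ml]) auto
  qed
  ultimately show ?thesis unfolding dims(1)[symmetric] by blast
qed

section \<open>Right denominators by transposition and conjugation\<close>

lemma H_inf_transpose:
  assumes "M \<in> H_inf p m"
  shows "(\<lambda>s. (M s)\<^sup>T) \<in> H_inf m p"
proof -
  have "(M s)\<^sup>T $$ (j, k) = M s $$ (k, j)" if "s \<in> open_rhp" "j < m" "k < p" for s j k
    using assms that by (auto simp: H_inf_def)
  then have "(\<lambda>s. (M s)\<^sup>T $$ (j, k)) ` open_rhp = (\<lambda>s. M s $$ (k, j)) ` open_rhp"
    "(\<lambda>s. (M s)\<^sup>T $$ (j, k)) holomorphic_on open_rhp \<longleftrightarrow> (\<lambda>s. M s $$ (k, j)) holomorphic_on open_rhp"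
    if "j < m" "k < p" for j k
    using that by (auto intro!: image_cong holomorphic_cong)
  then show ?thesis using assms by (simp add: H_inf_def)
qed

text \<open>Transposition reverses products, so the Bezout identity and the quotient both change
  sides, while determinants, poles and continuity are preserved.\<close>

lemma right_coprime_factorization_transpose:
  assumes fac: "right_coprime_factorization G M N"
  shows "left_coprime_factorization G\<^sup>T (\<lambda>s. (M s)\<^sup>T) (\<lambda>s. (N s)\<^sup>T)"
proof -
  obtain p m where dims: "p = dim_row G" "m = dim_col G" by simp
  have M: "M \<in> H_inf m m" and N: "N \<in> H_inf p m"
    and cont: "continuous_on_closed_rhp m M"
    and nz: "\<exists>s\<in>open_rhp. det (M s) \<noteq> 0"
    and quot: "\<And>s. s \<in> open_rhp \<Longrightarrow> det (M s) \<noteq> 0 \<Longrightarrow> \<not> tf_pole G s \<Longrightarrow>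
       tf_eval G s = N s * mat_inv (M s)"
    using fac unfolding right_coprime_factorization_def right_coprime_def dims by auto
  obtain X Y where X: "X \<in> H_inf m m" and Y: "Y \<in> H_inf m p"
    and bez: "\<And>s. s \<in> open_rhp \<Longrightarrow> X s * M s + Y s * N s = 1\<^sub>m m"
    using fac unfolding right_coprime_factorization_def right_coprime_def dims by auto
  have c: "M s \<in> carrier_mat m m" "N s \<in> carrier_mat p m" "X s \<in> carrier_mat m m" "Y s \<in> carrier_mat m p"
    if "s \<in> open_rhp" for s
    using that M N X Y by (auto simp: H_inf_def)
  have dt: "det (M s)\<^sup>T = det (M s)" if "s \<in> open_rhp" for s using det_transpose[OF c(1)[OF that]] .
  have "(M s)\<^sup>T * (X s)\<^sup>T + (N s)\<^sup>T * (Y s)\<^sup>T = 1\<^sub>m m" if s: "s \<in> open_rhp" for s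
  proof -
    have "(M s)\<^sup>T * (X s)\<^sup>T + (N s)\<^sup>T * (Y s)\<^sup>T = (X s * M s + Y s * N s)\<^sup>T"
      using c[OF s] by (subst transpose_add[of _ m m])
        (auto simp: transpose_mult[of _ m m _ m] transpose_mult[of _ m p _ m])
    then show ?thesis by (simp add: bez[OF s])
  qed
  then have "left_coprime m p (\<lambda>s. (M s)\<^sup>T) (\<lambda>s. (N s)\<^sup>T)"
    unfolding left_coprime_def
    by (intro conjI H_inf_transpose M N bexI[OF _ H_inf_transpose[OF X]]
        bexI[OF _ H_inf_transpose[OF Y]] ballI)
  moreover have "continuous_on_closed_rhp m (\<lambda>s. (M s)\<^sup>T)"
  proof -
    have "continuous_on closed_rhp (\<lambda>s. (M s)\<^sup>T $$ (j, k))" if "j < m" "k < m" for j k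
    proof -
      have "(M s)\<^sup>T $$ (j, k) = M s $$ (k, j)" if "s \<in> closed_rhp" for s
        using cont that \<open>j < m\<close> \<open>k < m\<close> by (auto simp: continuous_on_closed_rhp_def)
      then show ?thesis
        using cont that by (subst continuous_on_cong[OF refl]) (auto simp: continuous_on_closed_rhp_def)
    qed
    then show ?thesis using cont by (simp add: continuous_on_closed_rhp_def)
  qed
  moreover have "tf_eval G\<^sup>T s = mat_inv (M s)\<^sup>T * (N s)\<^sup>T"
    if s: "s \<in> open_rhp" "det (M s)\<^sup>T \<noteq> 0" "\<not> tf_pole G\<^sup>T s" for s
  proof -
    have d: "det (M s) \<noteq> 0" using s dt by simp
    have "tf_eval G\<^sup>T s = (N s * mat_inv (M s))\<^sup>T"
      using quot[OF s(1) d] s(3) by (simp add: tf_eval_transpose tf_pole_transpose)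
    also have "\<dots> = (mat_inv (M s))\<^sup>T * (N s)\<^sup>T"
      by (rule transpose_mult[of _ p m _ m]) (use c[OF s(1)] mat_inv(1)[OF _ d] in auto)
    finally show ?thesis by (simp add: mat_inv_transpose[OF c(1)[OF s(1)] d])
  qed
  ultimately show ?thesis
    unfolding left_coprime_factorization_def using nz dt by (simp flip: dims)
qed

text \<open>The adjoint is the entrywise conjugate of the transpose. This links the adjoints in the
  pole directions to the plain transposes used for duality.\<close>

lemma mat_adjoint_mult_conjugate:
  fixes A :: "complex mat"
  assumes "A \<in> carrier_mat p m" "v \<in> carrier_vec p"
  shows "mat_adjoint A *\<^sub>v conjugate v = conjugate (A\<^sup>T *\<^sub>v v)"
proof -
  have "mat_adjoint A = map_mat cnj A\<^sup>T"
    unfolding mat_adjoint_def using assms by (intro eq_matI) (auto simp: mat_of_rows_index)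
  then show ?thesis
    using assms by (intro eq_vecI) (auto simp: scalar_prod_def sum_conjugate)
qed

lemma mat_kernel_adjoint:
  fixes A :: "complex mat"
  assumes A: "A \<in> carrier_mat p m"
  shows "mat_kernel (mat_adjoint A) = conjugate ` mat_kernel A\<^sup>T"
proof -
  have Ac: "mat_adjoint A \<in> carrier_mat m p" 
    using A mat_of_rows_carrier(1)[of p "map conjugate (cols A)"] by (simp add: mat_adjoint_def)
  have iff: "conjugate v \<in> mat_kernel (mat_adjoint A) \<longleftrightarrow> v \<in> mat_kernel A\<^sup>T"
    if "v \<in> carrier_vec p" for v
    using that A by (simp add: mat_kernel[OF Ac] mat_kernel[of "A\<^sup>T" m p] mat_adjoint_mult_conjugate[OF A])
  show ?thesis
  proof (intro subset_antisym subsetI)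
    fix v assume v: "v \<in> mat_kernel (mat_adjoint A)"
    then have "conjugate v \<in> carrier_vec p" using mat_kernelD[OF Ac] by simp
    then show "v \<in> conjugate ` mat_kernel A\<^sup>T"
      using iff[of "conjugate v"] v by (intro image_eqI[of _ _ "conjugate v"]) auto
  next
    fix v assume "v \<in> conjugate ` mat_kernel A\<^sup>T"
    then show "v \<in> mat_kernel (mat_adjoint A)"
      using iff mat_kernelD[of "A\<^sup>T" m p] A by auto
  qed
qed

text \<open>The result for left denominators, applied to the transposed system at the same
  \<open>l\<close>, gives the equality with transposes; conjugating both subspaces turns these into
  adjoints.\<close>

lemma right_coprime_kernel:
  assumes min: "minimal_realization G A B C D"
    and fac: "right_coprime_factorization G M N" and l: "l \<in> closed_rhp"
  shows "mat_kernel (mat_adjoint (M l)) =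
    (\<lambda>v. mat_adjoint B *\<^sub>v v) ` mat_kernel (mat_adjoint (l \<cdot>\<^sub>m 1\<^sub>m (dim_row A) - A))"
proof -
  obtain n m where dims: "n = dim_row A" "m = dim_col G" by simp
  have A: "A \<in> carrier_mat n n" and B: "B \<in> carrier_mat n m"
    using min unfolding minimal_realization_def realization_def dims by auto
  let ?R = "l \<cdot>\<^sub>m 1\<^sub>m n - A"
  have R: "?R \<in> carrier_mat n n" using A by (rule minus_carrier_mat)
  have Ml: "M l \<in> carrier_mat m m"
    using fac l by (simp add: right_coprime_factorization_def continuous_on_closed_rhp_def dims)
  have "mat_kernel (M l)\<^sup>T = (\<lambda>v. B\<^sup>T *\<^sub>v v) ` mat_kernel ?R\<^sup>T"
    using left_coprime_kernel[OF minimal_realization_transpose[OF min]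
        right_coprime_factorization_transpose[OF fac] l] A
    by (simp add: resolvent_arg_transpose[OF A])
  then have "mat_kernel (mat_adjoint (M l)) = (\<lambda>v. conjugate (B\<^sup>T *\<^sub>v v)) ` mat_kernel ?R\<^sup>T"
    by (simp add: mat_kernel_adjoint[OF Ml] image_image)
  also have "\<dots> = (\<lambda>v. mat_adjoint B *\<^sub>v conjugate v) ` mat_kernel ?R\<^sup>T"
    by (intro image_cong refl) (use mat_adjoint_mult_conjugate[OF B] mat_kernelD[of "?R\<^sup>T" n n] R in auto)
  also have "\<dots> = (\<lambda>v. mat_adjoint B *\<^sub>v v) ` mat_kernel (mat_adjoint ?R)"
    by (simp add: mat_kernel_adjoint[OF R] image_image)
  finally show ?thesis by (simp only: dims)
qed

section \<open>The two equivalences\<close>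

lemma mat_kernel_eq_pdir_o:
  assumes "proper_tf G" "left_coprime_factorization G M N" "l \<in> closed_rhp"
  shows "mat_kernel (M l) = pdir_o G l"
  using left_coprime_kernel[OF some_minimal_realization[OF assms(1)] assms(2,3)]
  by (cases "some_minimal_realization G") (simp add: pdir_o_def)

lemma mat_kernel_adjoint_eq_pdir_i:
  assumes "proper_tf G" "right_coprime_factorization G M N" "l \<in> closed_rhp"
  shows "mat_kernel (mat_adjoint (M l)) = pdir_i G l"
  using right_coprime_kernel[OF some_minimal_realization[OF assms(1)] assms(2,3)]
  by (cases "some_minimal_realization G") (simp add: pdir_i_def)

theorem proposition4p1:
  fixes P :: "nat \<Rightarrow> real poly fract mat"
    and M N Mt Nt :: "nat \<Rightarrow> complex \<Rightarrow> complex mat"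
    and p m \<nu> :: nat
  assumes "1 \<le> \<nu>"
    and "\<And>i. i \<in> {1..\<nu>} \<Longrightarrow> P i \<in> carrier_mat p m"
    and "\<And>i. i \<in> {1..\<nu>} \<Longrightarrow> proper_tf (P i)"
    and "\<And>i. i \<in> {1..\<nu>} \<Longrightarrow> right_coprime_factorization (P i) (M i) (N i)"
    and "\<And>i. i \<in> {1..\<nu>} \<Longrightarrow> left_coprime_factorization (P i) (Mt i) (Nt i)"
  shows "((\<exists>l\<in>closed_rhp. (\<Inter>i\<in>{1..\<nu>}. mat_kernel (mat_adjoint (M i l))) \<noteq> {0\<^sub>v m}) \<longleftrightarrow>
          (\<exists>l\<in>closed_rhp. (\<Inter>i\<in>{1..\<nu>}. pdir_i (P i) l) \<noteq> {0\<^sub>v m}))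
       \<and> ((\<exists>l\<in>closed_rhp. (\<Inter>i\<in>{1..\<nu>}. mat_kernel (Mt i l)) \<noteq> {0\<^sub>v p}) \<longleftrightarrow>
          (\<exists>l\<in>closed_rhp. (\<Inter>i\<in>{1..\<nu>}. pdir_o (P i) l) \<noteq> {0\<^sub>v p}))"
proof -
  \<comment> \<open>The subspaces agree for each \<open>i\<close> at each \<open>l\<close>, so the
    intersections agree pointwise and the same \<open>l\<close> serves in both directions.\<close>
  have "(\<Inter>i\<in>{1..\<nu>}. mat_kernel (mat_adjoint (M i l))) = (\<Inter>i\<in>{1..\<nu>}. pdir_i (P i) l)"
    if "l \<in> closed_rhp" for l
    by (rule INF_cong[OF refl], rule mat_kernel_adjoint_eq_pdir_i[OF assms(3,4) that])
  moreover have "(\<Inter>i\<in>{1..\<nu>}. mat_kernel (Mt i l)) = (\<Inter>i\<in>{1..\<nu>}. pdir_o (P i) l)"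
    if "l \<in> closed_rhp" for l
    by (rule INF_cong[OF refl], rule mat_kernel_eq_pdir_o[OF assms(3,5) that])
  ultimately show ?thesis by simp
qed

end
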